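(* Suppose $\mathcal{H}$ is a hereditary $3$-graph property with $\mathrm{HOP}_2$ (the hyperplane order property). Then $\mathcal{H}$ requires non-binary $\mathrm{disc}_{2,3}$-error, i.e. $\mathcal{H}$ does not admit binary $\mathrm{disc}_{2,3}$-error.
   Context: For distinct $x,y,z$ write $xy=\{x,y\}$, $xyz=\{x,y,z\}$; $[n]=\{1,\dots,n\}$. $K_2[X,Y]=\{xy: x\in X,y\in Y,x\neq y\}$. A $3$-graph is a pair $H=(V,F)$ with $F\subseteq\binom{V}{3}$. A hereditary $3$-graph property is a class of finite $3$-graphs closed under isomorphism and induced sub-$3$-graphs. Given $H=(V,F)$, $\mathrm{Trip}(H)$ is the $3$-partite $3$-graph with vertex set $\{x_v:v\in V\}\cup\{y_v:v\in V\}\cup\{z_v:v\in V\}$ (three disjoint copies of $V$) and edge set $\{x_vy_{v'}z_{v''}:vv'v''\in F\}$. $\mathrm{HP}(k)$ is the $3$-partite $3$-graph with vertex set $\{a_i,b_i,c_i:i\in[k]\}$ and edge set $\{a_ub_vc_w:u+v+w\geq k+2\}$. $\mathcal{H}$ has $\mathrm{HOP}_2$ if for every $k\geq1$ there is $H\in\mathcal{H}$ such that $\mathrm{HP}(k)$ is isomorphic to an induced sub-$3$-graph of $\mathrm{Trip}(H)$. A bipartite graph $(U\cup W,E)$ with $|E|=d|U||W|$ has $\mathrm{disc}_2(\epsilon)$ if for all $U'\subseteq U$, $W'\subseteq W$, $\big||E\cap K_2[U',W']|-d|U'||W'|\big|\leq\epsilon|U||W|$; it has $\mathrm{disc}_2(\epsilon;d')$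 if moreover $\big||E|-d'|U||W|\big|\leq\epsilon|U||W|$. For a graph $G$, $K_3^{(2)}(G)$ is the set of vertex sets of triangles of $G$. If $G=(V_1\cup V_2\cup V_3,E)$ is a $3$-partite graph and $H'=(V_1\cup V_2\cup V_3,F')$ is a $3$-graph with $F'\subseteq K_3^{(2)}(G)$ and $|F'|=d_3|K_3^{(2)}(G)|$, then $(H',G)$ has $\mathrm{disc}_{2,3}(\epsilon_1,\epsilon_2)$ if there is $d_2\in(0,1]$ such that each bipartite graph $G[V_i,V_j]$ ($1\leq i<j\leq3$) has $\mathrm{disc}_2(\epsilon_2;d_2)$ and for every (not necessarily induced) subgraph $G'\subseteq G$, $\big||F'\cap K_3^{(2)}(G')|-d_3|K_3^{(2)}(G')|\big|\leq\epsilon_1d_2^3|V_1||V_2||V_3|$. A $(t,\ell,\epsilon_1,\epsilon_2)$-decomposition $\mathcal{P}$ of a set $V$ consists of a partition $V=V_1\cup\dots\cup V_t$ with $|V_1|\leq\dots\leq|V_t|\leq|V_1|+1$ and for each $ij\in\binom{[t]}{2}$ a partition $K_2[V_i,V_j]=\bigcup_{\alpha\leq\ell}P_{ij}^\alpha$, such that for all but at most $\epsilon_1|V|^3$ triples $xyz\in\binom V3$ there are $ijk\in\binom{[t]}{3}$ and $\alpha,\beta,\gamma\in[\ell]$ with $xy\in P^\alpha_{ij}$, $xz\in P^\beta_{ik}$, $yz\in P^\gamma_{jk}$, and each of $P^\alpha_{ij},P^\beta_{ik},P^\gamma_{jk}$ (as bipartite graphs) has $\mathrm{disc}_2(\epsilon_2;1/\ell)$.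 A triad of $\mathcal{P}$ is a $3$-partite graph $G_{ijk}^{\alpha,\beta,\gamma}=(V_i\cup V_j\cup V_k,P_{ij}^\alpha\cup P_{ik}^\beta\cup P_{jk}^\gamma)$ with $ijk\in\binom{[t]}{3}$, $\alpha,\beta,\gamma\in[\ell]$. For $H=(V,F)$, a triad $G$ of $\mathcal{P}$ has $\mathrm{disc}_{2,3}(\epsilon_1,\epsilon_2)$ with respect to $H$ if $(H',G)$ does, where $H'=(V_i\cup V_j\cup V_k,F\cap K_3^{(2)}(G))$. $\mathcal{H}$ admits binary $\mathrm{disc}_{2,3}$-error if for all $t_0,\ell_0\geq1$, $\epsilon_1>0$, $\epsilon_2:\mathbb{N}\to(0,1]$ there are $N,T,L$ such that for every $H=(V,F)\in\mathcal{H}$ with $|V|\geq N$ there are $t_0\leq t\leq T$, $\ell_0\leq\ell\leq L$, a $(t,\ell,\epsilon_1,\epsilon_2(\ell))$-decomposition $\mathcal{P}$ of $V$, and $\Gamma\subseteq\binom{[t]}{2}$ with $|\Gamma|\leq\epsilon_1t^2$ such that every triad $G_{ijk}^{\alpha,\beta,\gamma}$ of $\mathcal{P}$ with $ij,ik,jk\notin\Gamma$ has $\mathrm{disc}_{2,3}(\epsilon_1,\epsilon_2(\ell))$ with respect to $H$. *)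

theory Defs
  imports Complex_Main "HOL-Library.Ramsey" "HOL-Library.Disjoint_Sets"
begin

text \<open>
  A 3-graph is a pair of a vertex set and a set of three-element subsets of it; the set of all
  \<open>k\<close>-element subsets of \<open>A\<close> is \<open>nsets A k\<close>.
\<close>

type_synonym 'a hypergraph = "'a set \<times> 'a set set"

definition three_graph :: "'a hypergraph \<Rightarrow> bool" where
  "three_graph = (\<lambda>(V, F). F \<subseteq> nsets V 3)"

definition isomorphic :: "'a hypergraph \<Rightarrow> 'b hypergraph \<Rightarrow> bool" where
  "isomorphic = (\<lambda>(V, F) (V', F'). \<exists>f. bij_betw f V V' \<and> F' = (\<lambda>e. f ` e) ` F)"

definition induced_sub :: "'a hypergraph \<Rightarrow> 'a set \<Rightarrow> 'a hypergraph" where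
  "induced_sub = (\<lambda>(V, F) U. (U, F \<inter> nsets U 3))"

text \<open>
  A property is a class of finite 3-graphs whose vertices are taken from an arbitrary type. For an
  infinite vertex type, such as \<^typ>\<open>nat\<close>, every finite 3-graph has an isomorphic copy in the type,
  so that isomorphism-closed classes are captured without loss.
\<close>

definition hereditary_property :: "'a hypergraph set \<Rightarrow> bool" where
  "hereditary_property \<H> \<longleftrightarrow>
     (\<forall>H\<in>\<H>. finite (fst H) \<and> three_graph H) \<and>
     (\<forall>H\<in>\<H>. \<forall>H'. isomorphic H H' \<longrightarrow> H' \<in> \<H>) \<and>
     (\<forall>H\<in>\<H>. \<forall>U. U \<subseteq> fst H \<longrightarrow> induced_sub H U \<in> \<H>)"


subsection \<open>The hyperplane order property\<close>

text \<open>Three disjoint copies of a vertex set; also used for the vertices \<open>a\<^sub>i\<close>, \<open>b\<^sub>i\<close>, \<open>c\<^sub>i\<close>.\<close>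

datatype 'a copy = CopyX 'a | CopyY 'a | CopyZ 'a

definition Trip :: "'a hypergraph \<Rightarrow> 'a copy hypergraph" where
  "Trip = (\<lambda>(V, F).
     (CopyX ` V \<union> CopyY ` V \<union> CopyZ ` V,
      {{CopyX v, CopyY v', CopyZ v''} | v v' v''. {v, v', v''} \<in> F \<and>
         v \<noteq> v' \<and> v \<noteq> v'' \<and> v' \<noteq> v''}))"

definition HP :: "nat \<Rightarrow> nat copy hypergraph" where
  "HP k =
     (CopyX ` {1..k} \<union> CopyY ` {1..k} \<union> CopyZ ` {1..k},
      {{CopyX u, CopyY v, CopyZ w} | u v w.
         u \<in> {1..k} \<and> v \<in> {1..k} \<and> w \<in> {1..k} \<and> u + v + w \<ge> k + 2})"

definition HOP2 :: "'a hypergraph set \<Rightarrow> bool" where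
  "HOP2 \<H> \<longleftrightarrow>
     (\<forall>k\<ge>1. \<exists>H\<in>\<H>. \<exists>U. U \<subseteq> fst (Trip H) \<and> isomorphic (HP k) (induced_sub (Trip H) U))"


subsection \<open>Quasirandomness\<close>

text \<open>Graphs are given by their edge sets, with the vertex classes passed separately.\<close>

definition K2 :: "'a set \<Rightarrow> 'a set \<Rightarrow> 'a set set" where
  "K2 X Y = {{x, y} | x y. x \<in> X \<and> y \<in> Y \<and> x \<noteq> y}"

definition bipartite_graph :: "'a set \<Rightarrow> 'a set \<Rightarrow> 'a set set \<Rightarrow> bool" where
  "bipartite_graph U W E \<longleftrightarrow> U \<inter> W = {} \<and> E \<subseteq> K2 U W"

definition disc2 :: "real \<Rightarrow> 'a set \<Rightarrow> 'a set \<Rightarrow> 'a set set \<Rightarrow> bool" where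
  "disc2 \<epsilon> U W E \<longleftrightarrow>
     bipartite_graph U W E \<and>
     (\<exists>d. real (card E) = d * real (card U) * real (card W) \<and>
        (\<forall>U' W'. U' \<subseteq> U \<and> W' \<subseteq> W \<longrightarrow>
           \<bar>real (card (E \<inter> K2 U' W')) - d * real (card U') * real (card W')\<bar>
             \<le> \<epsilon> * real (card U) * real (card W)))"

definition disc2_dens :: "real \<Rightarrow> real \<Rightarrow> 'a set \<Rightarrow> 'a set \<Rightarrow> 'a set set \<Rightarrow> bool" where
  "disc2_dens \<epsilon> d' U W E \<longleftrightarrow>
     disc2 \<epsilon> U W E \<and>
     \<bar>real (card E) - d' * real (card U) * real (card W)\<bar> \<le> \<epsilon> * real (card U) * real (card W)"

definition K3 :: "'a set set \<Rightarrow> 'a set set" where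
  "K3 E = {{x, y, z} | x y z. x \<noteq> y \<and> x \<noteq> z \<and> y \<noteq> z \<and> {x, y} \<in> E \<and> {x, z} \<in> E \<and> {y, z} \<in> E}"

definition tripartite_graph :: "'a set \<Rightarrow> 'a set \<Rightarrow> 'a set \<Rightarrow> 'a set set \<Rightarrow> bool" where
  "tripartite_graph V1 V2 V3 E \<longleftrightarrow>
     V1 \<inter> V2 = {} \<and> V1 \<inter> V3 = {} \<and> V2 \<inter> V3 = {} \<and> E \<subseteq> K2 V1 V2 \<union> K2 V1 V3 \<union> K2 V2 V3"

text \<open>
  In \<open>disc23 \<epsilon>1 \<epsilon>2 V1 V2 V3 E F'\<close> the pair under consideration consists of the 3-graph with edge
  set \<open>F'\<close> and the graph with edge set \<open>E\<close>. Only the edge set \<open>E'\<close> of a subgraph matters for its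
  triangles, so its vertex set is not mentioned.
\<close>

definition disc23 ::
  "real \<Rightarrow> real \<Rightarrow> 'a set \<Rightarrow> 'a set \<Rightarrow> 'a set \<Rightarrow> 'a set set \<Rightarrow> 'a set set \<Rightarrow> bool" where
  "disc23 \<epsilon>1 \<epsilon>2 V1 V2 V3 E F' \<longleftrightarrow>
     tripartite_graph V1 V2 V3 E \<and> F' \<subseteq> K3 E \<and>
     (\<exists>d3. real (card F') = d3 * real (card (K3 E)) \<and>
        (\<exists>d2. 0 < d2 \<and> d2 \<le> 1 \<and>
           disc2_dens \<epsilon>2 d2 V1 V2 (E \<inter> K2 V1 V2) \<and>
           disc2_dens \<epsilon>2 d2 V1 V3 (E \<inter> K2 V1 V3) \<and>
           disc2_dens \<epsilon>2 d2 V2 V3 (E \<inter> K2 V2 V3) \<and>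
           (\<forall>E'. E' \<subseteq> E \<longrightarrow>
              \<bar>real (card (F' \<inter> K3 E')) - d3 * real (card (K3 E'))\<bar>
                \<le> \<epsilon>1 * d2 ^ 3 * real (card V1) * real (card V2) * real (card V3))))"


subsection \<open>Decompositions\<close>

text \<open>
  A decomposition is given by the vertex classes \<open>A i\<close> for \<open>i \<in> {1..t}\<close> and the classes
  \<open>P {i, j} \<alpha>\<close> of pairs for \<open>\<alpha> \<in> {1..l}\<close>, the first index of \<open>P\<close> being the unordered pair \<open>ij\<close>.
  Classes may be empty.
\<close>

definition distinct_in :: "nat \<Rightarrow> nat \<Rightarrow> nat \<Rightarrow> nat \<Rightarrow> bool" where
  "distinct_in t i j k \<longleftrightarrow> {i, j, k} \<subseteq> {1..t} \<and> i \<noteq> j \<and> i \<noteq> k \<and> j \<noteq> k"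

definition regular_triple ::
  "nat \<Rightarrow> nat \<Rightarrow> real \<Rightarrow> (nat \<Rightarrow> 'a set) \<Rightarrow> (nat set \<Rightarrow> nat \<Rightarrow> 'a set set) \<Rightarrow> 'a set \<Rightarrow> bool" where
  "regular_triple t l \<epsilon>2 A P e \<longleftrightarrow>
     (\<exists>x y z i j k. \<exists>\<alpha>\<in>{1..l}. \<exists>\<beta>\<in>{1..l}. \<exists>\<gamma>\<in>{1..l}.
        e = {x, y, z} \<and> distinct_in t i j k \<and>
        {x, y} \<in> P {i, j} \<alpha> \<and> {x, z} \<in> P {i, k} \<beta> \<and> {y, z} \<in> P {j, k} \<gamma> \<and>
        disc2_dens \<epsilon>2 (1 / real l) (A i) (A j) (P {i, j} \<alpha>) \<and>
        disc2_dens \<epsilon>2 (1 / real l) (A i) (A k) (P {i, k} \<beta>) \<and>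
        disc2_dens \<epsilon>2 (1 / real l) (A j) (A k) (P {j, k} \<gamma>))"

definition decomposition ::
  "nat \<Rightarrow> nat \<Rightarrow> real \<Rightarrow> real \<Rightarrow> 'a set \<Rightarrow>
     (nat \<Rightarrow> 'a set) \<Rightarrow> (nat set \<Rightarrow> nat \<Rightarrow> 'a set set) \<Rightarrow> bool" where
  "decomposition t l \<epsilon>1 \<epsilon>2 V A P \<longleftrightarrow>
     V = (\<Union>i\<in>{1..t}. A i) \<and> disjoint_family_on A {1..t} \<and>
     (\<forall>i\<in>{1..t}. \<forall>j\<in>{1..t}. i \<le> j \<longrightarrow> card (A i) \<le> card (A j)) \<and> card (A t) \<le> card (A 1) + 1 \<and>
     (\<forall>i\<in>{1..t}. \<forall>j\<in>{1..t}. i \<noteq> j \<longrightarrow>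
        K2 (A i) (A j) = (\<Union>\<alpha>\<in>{1..l}. P {i, j} \<alpha>) \<and> disjoint_family_on (P {i, j}) {1..l}) \<and>
     real (card {e \<in> nsets V 3. \<not> regular_triple t l \<epsilon>2 A P e}) \<le> \<epsilon>1 * real (card V) ^ 3"

definition triad ::
  "(nat set \<Rightarrow> nat \<Rightarrow> 'a set set) \<Rightarrow> nat \<Rightarrow> nat \<Rightarrow> nat \<Rightarrow> nat \<Rightarrow> nat \<Rightarrow> nat \<Rightarrow> 'a set set" where
  "triad P i j k \<alpha> \<beta> \<gamma> = P {i, j} \<alpha> \<union> P {i, k} \<beta> \<union> P {j, k} \<gamma>"

definition admits_binary_disc23_error :: "'a hypergraph set \<Rightarrow> bool" where
  "admits_binary_disc23_error \<H> \<longleftrightarrow>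
     (\<forall>t\<^sub>0 l\<^sub>0 :: nat. \<forall>\<epsilon>1 :: real. \<forall>\<epsilon>2 :: nat \<Rightarrow> real.
        t\<^sub>0 \<ge> 1 \<and> l\<^sub>0 \<ge> 1 \<and> \<epsilon>1 > 0 \<and> (\<forall>n. 0 < \<epsilon>2 n \<and> \<epsilon>2 n \<le> 1) \<longrightarrow>
        (\<exists>N T L :: nat. \<forall>(V, F)\<in>\<H>. card V \<ge> N \<longrightarrow>
           (\<exists>t l A P \<Gamma>.
              t\<^sub>0 \<le> t \<and> t \<le> T \<and> l\<^sub>0 \<le> l \<and> l \<le> L \<and>
              decomposition t l \<epsilon>1 (\<epsilon>2 l) V A P \<and>
              \<Gamma> \<subseteq> nsets {1..t} 2 \<and> real (card \<Gamma>) \<le> \<epsilon>1 * real t ^ 2 \<and>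
              (\<forall>i j k. \<forall>\<alpha>\<in>{1..l}. \<forall>\<beta>\<in>{1..l}. \<forall>\<gamma>\<in>{1..l}.
                 distinct_in t i j k \<and> {i, j} \<notin> \<Gamma> \<and> {i, k} \<notin> \<Gamma> \<and> {j, k} \<notin> \<Gamma> \<longrightarrow>
                 disc23 \<epsilon>1 (\<epsilon>2 l) (A i) (A j) (A k) (triad P i j k \<alpha> \<beta> \<gamma>)
                   (F \<inter> K3 (triad P i j k \<alpha> \<beta> \<gamma>))))))"

end

theory Submission
  imports Defs
begin

text \<open>
  A large copy of \<open>HP k\<close> in \<open>Trip H\<close> yields an induced sub-3-graph of \<open>H\<close> on disjoint sets
  \<open>{x u}\<close>, \<open>{y v}\<close>, \<open>{z w}\<close> of size \<open>k\<close> in which \<open>x u, y v, z w\<close> is an edge iff \<open>u + v + w \<ge> k + 2\<close>.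
  Given a decomposition, sample a solution of \<open>u + v + w = k + 2\<close> uniformly. Any two of \<open>u, v, w\<close>
  determine the third, so the pairs of classes of \<open>x u, y v, z w\<close> rarely lie in the sparse set \<open>\<Gamma>\<close>,
  and each of the three vertices is typically central in its class: a positive proportion of the
  class consists of \<open>x u'\<close> with \<open>u' < u\<close>, and likewise with \<open>u' \<ge> u\<close>. For such a solution the three classes
  contain a large box without edges and a large box in which all triples are edges. In the triad
  formed by the densest pair classes both boxes have many triangles, so its relative density would
  have to be close to both 0 and 1.
\<close>

subsection \<open>Hyperplane configurations\<close>

fun kind :: "'a copy \<Rightarrow> nat" where
  "kind (CopyX _) = 0" | "kind (CopyY _) = 1" | "kind (CopyZ _) = 2"

fun base :: "'a copy \<Rightarrow> 'a" where
  "base (CopyX v) = v" | "base (CopyY v) = v" | "base (CopyZ v) = v"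

lemma kind_base_eq_iff: "p = q \<longleftrightarrow> kind p = kind q \<and> base p = base q"
  by (cases p; cases q) auto

text \<open>An embedding of \<open>HP k\<close> into \<open>Trip H\<close> need not respect the
  names of the three copies. The edge condition is therefore stated for vertices whose kinds come in
  any order, with \<open>kind\<close> and \<open>base\<close> separating the copy from the
  underlying vertex.\<close>

lemma Trip_edge_iff:
  "{p, q, r} \<in> snd (Trip (V, F)) \<longleftrightarrow>
     kind p \<noteq> kind q \<and> kind p \<noteq> kind r \<and> kind q \<noteq> kind r \<and>
     base p \<noteq> base q \<and> base p \<noteq> base r \<and> base q \<noteq> base r \<and> {base p, base q, base r} \<in> F"
  (is "?L \<longleftrightarrow> ?R")
proof
  assume ?L
  then obtain v v' v'' where
    e: "{p, q, r} = {CopyX v, CopyY v', CopyZ v''}" "{v, v', v''} \<in> F" "v \<noteq> v'" "v \<noteq> v''" "v' \<noteq> v''"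
    by (auto simp: Trip_def)
  have "base ` {p, q, r} = {v, v', v''}" and "kind ` {p, q, r} = {0, 1, 2}"
    unfolding e(1) by auto
  then have b: "{base p, base q, base r} = {v, v', v''}" and k: "{kind p, kind q, kind r} = {0, 1, 2}"
    by auto
  \<comment> \<open>Three listed values forming a set of size 3 are pairwise distinct, which yields
    all six inequations at once.\<close>
  have "card {base p, base q, base r} = 3" "card {kind p, kind q, kind r} = 3"
    unfolding b k using e by auto
  then show ?R
    using e(2) unfolding b[symmetric] by (auto simp: card_insert_if split: if_splits)
next
  assume R: ?R
  have *: "{CopyX v, CopyY v', CopyZ v''} \<in> snd (Trip (V, F))"
    if "{v, v', v''} \<in> F" "v \<noteq> v'" "v \<noteq> v''" "v' \<noteq> v''" for v v' v''
    using that by (auto simp: Trip_def)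
  obtain x y z where "{p, q, r} = {CopyX x, CopyY y, CopyZ z}" "{base p, base q, base r} = {x, y, z}"
    "x \<noteq> y" "x \<noteq> z" "y \<noteq> z"
  proof -
    assume "\<And>x y z. {p, q, r} = {CopyX x, CopyY y, CopyZ z} \<Longrightarrow> {base p, base q, base r} = {x, y, z} \<Longrightarrow>
      x \<noteq> y \<Longrightarrow> x \<noteq> z \<Longrightarrow> y \<noteq> z \<Longrightarrow> thesis"
    from R this show ?thesis
      by (cases p; cases q; cases r; simp; blast)
  qed
  with R * show ?L by metis
qed

lemma HP_edge_iff:
  assumes "u \<in> {1..k}" "v \<in> {1..k}" "w \<in> {1..k}"
  shows "{CopyX u, CopyY v, CopyZ w} \<in> snd (HP k) \<longleftrightarrow> k + 2 \<le> u + v + w"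
proof -
  have "u' = u \<and> v' = v \<and> w' = w" if "{CopyX u, CopyY v, CopyZ w} = {CopyX u', CopyY v', CopyZ w'}"
    for u' v' w' :: nat
    using that by (auto simp: set_eq_iff)
  then show ?thesis using assms by (fastforce simp: HP_def)
qed

text \<open>The sides of \<open>HP k\<close> are projected from \<open>Trip H\<close> to
  \<open>H\<close>. Any two vertices from different sides lie in a common edge, and edges of
  \<open>Trip H\<close> have distinct kinds and distinct bases; so the projected sides are disjoint.
  Heredity then allows the restriction to their union.\<close>

lemma hyperplane_representation:
  fixes \<H> :: "'a hypergraph set"
  assumes her: "hereditary_property \<H>" and hop: "HOP2 \<H>" and k: "k \<ge> 1"
  obtains V F and x y z :: "nat \<Rightarrow> 'a" where
    "(V, F) \<in> \<H>" "V = x ` {1..k} \<union> y ` {1..k} \<union> z ` {1..k}"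
    "inj_on x {1..k}" "inj_on y {1..k}" "inj_on z {1..k}"
    "x ` {1..k} \<inter> y ` {1..k} = {}" "x ` {1..k} \<inter> z ` {1..k} = {}" "y ` {1..k} \<inter> z ` {1..k} = {}"
    "\<And>u v w. u \<in> {1..k} \<Longrightarrow> v \<in> {1..k} \<Longrightarrow> w \<in> {1..k} \<Longrightarrow>
       {x u, y v, z w} \<in> F \<longleftrightarrow> k + 2 \<le> u + v + w"
proof -
  obtain H U where "H \<in> \<H>" and U: "U \<subseteq> fst (Trip H)" "isomorphic (HP k) (induced_sub (Trip H) U)"
    using hop k unfolding HOP2_def by blast
  obtain V0 F0 where H: "H = (V0, F0)" by (cases H)
  obtain f where f: "bij_betw f (fst (HP k)) U"
    and fF: "snd (Trip H) \<inter> nsets U 3 = (\<lambda>e. f ` e) ` snd (HP k)"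
    using U(2) by (auto simp: isomorphic_def induced_sub_def split: prod.splits)
  define a b c where "a = f \<circ> CopyX" "b = f \<circ> CopyY" "c = f \<circ> CopyZ"
  have vert: "CopyX u \<in> fst (HP k)" "CopyY u \<in> fst (HP k)" "CopyZ u \<in> fst (HP k)" if "u \<in> {1..k}" for u
    using that by (auto simp: HP_def)
  have inj: "inj_on f (fst (HP k))" using f by (rule bij_betw_imp_inj_on)
  have sub: "e \<subseteq> fst (HP k)" if "e \<in> snd (HP k)" for e
    using that by (auto simp: HP_def)
  have edge: "{a u, b v, c w} \<in> snd (Trip H) \<longleftrightarrow> k + 2 \<le> u + v + w"
    if uvw: "u \<in> {1..k}" "v \<in> {1..k}" "w \<in> {1..k}" for u v w
  proof -
    let ?e = "{CopyX u, CopyY v, CopyZ w}"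
    have e: "?e \<subseteq> fst (HP k)" using vert uvw by auto
    have fe: "f ` ?e = {a u, b v, c w}" by (simp add: a_b_c_def)
    have "card (f ` ?e) = 3" using e card_image[OF inj_on_subset[OF inj e]] by simp
    moreover have "f ` ?e \<subseteq> U" using e f by (auto simp: bij_betw_def)
    ultimately have "f ` ?e \<in> nsets U 3" by (auto simp: nsets_def)
    then have "{a u, b v, c w} \<in> snd (Trip H) \<longleftrightarrow> f ` ?e \<in> (\<lambda>e. f ` e) ` snd (HP k)"
      unfolding fF[symmetric] fe by auto
    also have "\<dots> \<longleftrightarrow> ?e \<in> snd (HP k)"
      using inj_on_image_eq_iff[OF inj] sub e by (auto simp del: image_insert)
    finally show ?thesis using HP_edge_iff[OF uvw] by simp
  qed
  \<comment> \<open>With third index \<open>k\<close> the sum is at least \<open>k + 2\<close>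
    whatever the other two indices are, so every pair across two sides extends to an edge.\<close>
  have kk: "k \<in> {1..k}" using k by simp
  note te = edge[unfolded H Trip_edge_iff]
  have ab: "kind (a u) \<noteq> kind (b v) \<and> base (a u) \<noteq> base (b v)" if "u \<in> {1..k}" "v \<in> {1..k}" for u v
    using te[OF that kk] that by auto
  have ac: "kind (a u) \<noteq> kind (c v) \<and> base (a u) \<noteq> base (c v)" if "u \<in> {1..k}" "v \<in> {1..k}" for u v
    using te[OF that(1) kk that(2)] that by auto
  have bc: "kind (b u) \<noteq> kind (c v) \<and> base (b u) \<noteq> base (c v)" if "u \<in> {1..k}" "v \<in> {1..k}" for u v
    using te[OF kk that] that by auto
  have k3: "kind p < 3" for p :: "'a copy" by (cases p) auto
  \<comment> \<open>\<open>b k\<close> and \<open>c k\<close> have different kinds and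
    \<open>a u\<close> avoids both, which leaves only one of the three kinds.\<close>
  have ka: "kind (a u) = kind (a k)" if "u \<in> {1..k}" for u
    using ab[OF that kk] ac[OF that kk] ab[OF kk kk] ac[OF kk kk] bc[OF kk kk]
      k3[of "a u"] k3[of "a k"] k3[of "b k"] k3[of "c k"] by linarith
  have kb: "kind (b u) = kind (b k)" if "u \<in> {1..k}" for u
    using ab[OF kk that] bc[OF that kk] ab[OF kk kk] ac[OF kk kk] bc[OF kk kk]
      k3[of "b u"] k3[of "a k"] k3[of "b k"] k3[of "c k"] by linarith
  have kc: "kind (c u) = kind (c k)" if "u \<in> {1..k}" for u
    using ac[OF kk that] bc[OF kk that] ab[OF kk kk] ac[OF kk kk] bc[OF kk kk]
      k3[of "c u"] k3[of "a k"] k3[of "b k"] k3[of "c k"] by linarith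
  \<comment> \<open>On one side the kind is constant, so equal bases force equal vertices of
    \<open>Trip H\<close>, and the injectivity of \<open>f\<close> applies.\<close>
  have ia: "inj_on (base \<circ> a) {1..k}"
  proof (rule inj_onI)
    fix u v assume uv: "u \<in> {1..k}" "v \<in> {1..k}" "(base \<circ> a) u = (base \<circ> a) v"
    then have "a u = a v" using ka by (metis comp_apply kind_base_eq_iff)
    then show "u = v" using inj_onD[OF inj, of "CopyX u" "CopyX v"] uv vert by (auto simp: a_b_c_def)
  qed
  have ib: "inj_on (base \<circ> b) {1..k}"
  proof (rule inj_onI)
    fix u v assume uv: "u \<in> {1..k}" "v \<in> {1..k}" "(base \<circ> b) u = (base \<circ> b) v"
    then have "b u = b v" using kb by (metis comp_apply kind_base_eq_iff)
    then show "u = v" using inj_onD[OF inj, of "CopyY u" "CopyY v"] uv vert by (auto simp: a_b_c_def)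
  qed
  have ic: "inj_on (base \<circ> c) {1..k}"
  proof (rule inj_onI)
    fix u v assume uv: "u \<in> {1..k}" "v \<in> {1..k}" "(base \<circ> c) u = (base \<circ> c) v"
    then have "c u = c v" using kc by (metis comp_apply kind_base_eq_iff)
    then show "u = v" using inj_onD[OF inj, of "CopyZ u" "CopyZ v"] uv vert by (auto simp: a_b_c_def)
  qed
  \<comment> \<open>Edges with two vertices on the same side remain arbitrary; only transversal
    triples are controlled.\<close>
  let ?W = "(base \<circ> a) ` {1..k} \<union> (base \<circ> b) ` {1..k} \<union> (base \<circ> c) ` {1..k}"
  have "base p \<in> V0" if "p \<in> U" for p
    using U(1) that by (auto simp: H Trip_def)
  moreover have "a u \<in> U" "b u \<in> U" "c u \<in> U" if "u \<in> {1..k}" for u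
    using vert[OF that] f by (auto simp: a_b_c_def bij_betw_def)
  ultimately have "?W \<subseteq> V0" by auto
  then have mem: "(?W, F0 \<inter> nsets ?W 3) \<in> \<H>"
    using her \<open>H \<in> \<H>\<close> unfolding hereditary_property_def H induced_sub_def by force
  show ?thesis
  proof (rule that[OF mem refl ia ib ic])
    show "(base \<circ> a) ` {1..k} \<inter> (base \<circ> b) ` {1..k} = {}" using ab by auto
    show "(base \<circ> a) ` {1..k} \<inter> (base \<circ> c) ` {1..k} = {}" using ac by auto
    show "(base \<circ> b) ` {1..k} \<inter> (base \<circ> c) ` {1..k} = {}" using bc by auto
    fix u v w assume uvw: "u \<in> {1..k}" "v \<in> {1..k}" "w \<in> {1..k}"
    have "{(base \<circ> a) u, (base \<circ> b) v, (base \<circ> c) w} \<in> nsets ?W 3"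
      using uvw ab[OF uvw(1,2)] ac[OF uvw(1,3)] bc[OF uvw(2,3)] by (auto simp: nsets_def)
    then show "{(base \<circ> a) u, (base \<circ> b) v, (base \<circ> c) w} \<in> F0 \<inter> nsets ?W 3 \<longleftrightarrow> k + 2 \<le> u + v + w"
      using te[OF uvw] ab[OF uvw(1,2)] ac[OF uvw(1,3)] bc[OF uvw(2,3)] by auto
  qed
qed

subsection \<open>Central solutions of u + v + w = k + 2\<close>

text \<open>All elements with few predecessors, except the largest of them, are predecessors of that
  largest one, which has fewer than \<open>c\<close>. The extra 1 accounts for the largest element
  itself.\<close>

lemma card_few_below:
  fixes S :: "nat set" and c :: real
  assumes "finite S" "0 \<le> c"
  shows "real (card {u \<in> S. real (card {u' \<in> S. u' < u}) < c}) \<le> c + 1"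
proof (cases "{u \<in> S. real (card {u' \<in> S. u' < u}) < c} = {}")
  case True
  then show ?thesis using assms by (simp only: card.empty)
next
  case False
  let ?L = "{u \<in> S. real (card {u' \<in> S. u' < u}) < c}"
  have fin: "finite ?L" using assms by simp
  have M: "Max ?L \<in> ?L" using Max_in[OF fin False] .
  have "?L - {Max ?L} \<subseteq> {u' \<in> S. u' < Max ?L}"
  proof
    fix u assume "u \<in> ?L - {Max ?L}"
    then have "u \<in> ?L" "u \<noteq> Max ?L" by auto
    then show "u \<in> {u' \<in> S. u' < Max ?L}" using Max_ge[OF fin, of u] by auto
  qed
  then have "card (?L - {Max ?L}) \<le> card {u' \<in> S. u' < Max ?L}"
    using assms by (intro card_mono) auto
  moreover have "real (card {u' \<in> S. u' < Max ?L}) < c" using M by blast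
  moreover have "card ?L = card (?L - {Max ?L}) + 1"
    using card_Suc_Diff1[OF fin M] by simp
  ultimately show ?thesis by linarith
qed

lemma card_few_above:
  fixes S :: "nat set" and c :: real
  assumes "finite S" "0 \<le> c"
  shows "real (card {u \<in> S. real (card {u' \<in> S. u \<le> u'}) < c}) \<le> c + 1"
proof (cases "{u \<in> S. real (card {u' \<in> S. u \<le> u'}) < c} = {}")
  case True
  then show ?thesis using assms by (simp only: card.empty)
next
  case False
  let ?L = "{u \<in> S. real (card {u' \<in> S. u \<le> u'}) < c}"
  have fin: "finite ?L" using assms by simp
  have M: "Min ?L \<in> ?L" using Min_in[OF fin False] .
  have "?L \<subseteq> {u' \<in> S. Min ?L \<le> u'}"
    using Min_le[OF fin] by blast
  then have "card ?L \<le> card {u' \<in> S. Min ?L \<le> u'}"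
    using assms by (intro card_mono) auto
  moreover have "real (card {u' \<in> S. Min ?L \<le> u'}) < c" using M by blast
  ultimately show ?thesis by linarith
qed

text \<open>\<open>p\<close> sends an index to the class of its vertex. The comparison is strict
  below and weak above because, at a solution of \<open>u + v + w = k + 2\<close>, strictly smaller
  indices sum to less than the threshold of \<open>HP k\<close>, while indices at or above the
  solution reach it.\<close>

definition peripheral :: "(nat \<Rightarrow> nat) \<Rightarrow> nat \<Rightarrow> real \<Rightarrow> nat set" where
  "peripheral p k c = {u \<in> {1..k}.
     real (card {u' \<in> {1..k}. p u' = p u \<and> u' < u}) < c \<or>
     real (card {u' \<in> {1..k}. p u' = p u \<and> u \<le> u'}) < c}"

text \<open>Being peripheral depends only on the own class of the index, so each of the
  \<open>t\<close> classes contributes at most \<open>c + 1\<close> indices at its lower end and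
  \<open>c + 1\<close> at its upper end.\<close>

lemma card_peripheral:
  assumes p: "p ` {1..k} \<subseteq> {1..t}" and c: "0 \<le> c"
  shows "real (card (peripheral p k c)) \<le> 2 * real t * (c + 1)"
proof -
  define S where "S i = {u \<in> {1..k}. p u = i}" for i
  define L where "L i = {u \<in> S i. real (card {u' \<in> S i. u' < u}) < c} \<union>
     {u \<in> S i. real (card {u' \<in> S i. u \<le> u'}) < c}" for i
  have fS: "finite (S i)" for i by (simp add: S_def)
  have L: "real (card (L i)) \<le> 2 * (c + 1)" for i
  proof -
    have "real (card (L i)) \<le> real (card {u \<in> S i. real (card {u' \<in> S i. u' < u}) < c}) +
      real (card {u \<in> S i. real (card {u' \<in> S i. u \<le> u'}) < c})"
      unfolding L_def of_nat_add[symmetric] of_nat_le_iff by (rule card_Un_le)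
    also have "\<dots> \<le> (c + 1) + (c + 1)"
      by (rule add_mono[OF card_few_below[OF fS c] card_few_above[OF fS c]])
    finally show ?thesis by simp
  qed
  have "peripheral p k c \<subseteq> (\<Union>i\<in>{1..t}. L i)"
  proof
    fix u assume u: "u \<in> peripheral p k c"
    then have "u \<in> L (p u)" by (auto simp: peripheral_def L_def S_def)
    moreover have "p u \<in> {1..t}" using u p unfolding peripheral_def by blast
    ultimately show "u \<in> (\<Union>i\<in>{1..t}. L i)" by blast
  qed
  then have "card (peripheral p k c) \<le> card (\<Union>i\<in>{1..t}. L i)"
    by (intro card_mono) (auto simp: L_def fS)
  also have "\<dots> \<le> (\<Sum>i\<in>{1..t}. card (L i))"
    by (rule card_UN_le) simp
  finally have "real (card (peripheral p k c)) \<le> (\<Sum>i\<in>{1..t}. real (card (L i)))"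
    by (simp flip: of_nat_sum)
  also have "\<dots> \<le> real (card {1..t}) * (2 * (c + 1))"
    by (rule sum_bounded_above) (rule L)
  finally show ?thesis by (simp add: mult_ac)
qed

lemma card_pairs_in_classes:
  fixes p q :: "nat \<Rightarrow> nat" and m :: real
  assumes G: "finite G" and fin: "finite S" "finite S'"
    and p: "\<And>i. real (card {u \<in> S. p u = i}) \<le> m" and q: "\<And>i. real (card {u \<in> S'. q u = i}) \<le> m"
  shows "real (card {(u, v) \<in> S \<times> S'. (p u, q v) \<in> G}) \<le> real (card G) * m\<^sup>2"
proof -
  have m: "0 \<le> m" using p[of 0] by linarith
  let ?B = "\<lambda>g. {u \<in> S. p u = fst g} \<times> {v \<in> S'. q v = snd g}"
  have "{(u, v) \<in> S \<times> S'. (p u, q v) \<in> G} \<subseteq> (\<Union>g\<in>G. ?B g)"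
    by auto
  then have "card {(u, v) \<in> S \<times> S'. (p u, q v) \<in> G} \<le> card (\<Union>g\<in>G. ?B g)"
    using fin G by (intro card_mono) auto
  also have "\<dots> \<le> (\<Sum>g\<in>G. card (?B g))"
    by (rule card_UN_le[OF G])
  finally have "real (card {(u, v) \<in> S \<times> S'. (p u, q v) \<in> G}) \<le> (\<Sum>g\<in>G. real (card (?B g)))"
    by (simp flip: of_nat_sum)
  also have "\<dots> \<le> real (card G) * m\<^sup>2"
  proof (rule sum_bounded_above)
    fix g show "real (card (?B g)) \<le> m\<^sup>2"
      unfolding card_cartesian_product of_nat_mult power2_eq_square
      by (intro mult_mono p q m) auto
  qed
  finally show ?thesis .
qed

text \<open>These pairs parametrise the solutions of \<open>u + v + w = k + 2\<close> in
  \<open>{1..k}\<close>: the condition says that the third index is at least 1, and it is at most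
  \<open>k\<close> since \<open>u\<close> and \<open>v\<close> are positive. Their number is
  \<open>k * (k + 1) / 2\<close>.\<close>

lemma card_triangle_pairs:
  "real (card {(u, v) \<in> {1..k} \<times> {1..k}. u + v \<le> k + 1}) \<ge> real k ^ 2 / 2"
proof -
  have "{(u, v) \<in> {1..k} \<times> {1..k}. u + v \<le> k + 1} = (SIGMA u:{1..k}. {1..k + 1 - u})"
    by auto
  then have "card {(u, v) \<in> {1..k} \<times> {1..k}. u + v \<le> k + 1} = (\<Sum>u\<in>{1..k}. k + 1 - u)"
    by simp
  also have "\<dots> = (\<Sum>u\<in>{1..k}. u)"
    by (rule sum.reindex_bij_witness[of _ "\<lambda>u. k + 1 - u" "\<lambda>u. k + 1 - u"]) auto
  finally have "card {(u, v) \<in> {1..k} \<times> {1..k}. u + v \<le> k + 1} = (\<Sum>u\<in>{1..k}. u)" .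
  then have "2 * real (card {(u, v) \<in> {1..k} \<times> {1..k}. u + v \<le> k + 1}) = 2 * (\<Sum>u\<in>{1..k}. real u)"
    by (simp only: of_nat_sum)
  also have "\<dots> = real k * (real k + 1)"
    using double_gauss_sum_from_Suc_0[where n = k and 'a = real] by (simp only: One_nat_def)
  finally show ?thesis by (simp add: power2_eq_square distrib_left)
qed

text \<open>A union bound over six bad events. Two coordinates determine a solution, so each event
  injects into a set of pairs: a peripheral coordinate paired with any index, or two indices whose
  classes form a pair in \<open>G\<close>. The assumption \<open>small\<close> keeps the total below
  the number of solutions.\<close>

lemma exists_central_solution:
  fixes p q r :: "nat \<Rightarrow> nat" and m c :: real
  assumes p: "p ` {1..k} \<subseteq> {1..t}" "\<And>i. real (card {u \<in> {1..k}. p u = i}) \<le> m"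
    and q: "q ` {1..k} \<subseteq> {1..t}" "\<And>i. real (card {u \<in> {1..k}. q u = i}) \<le> m"
    and r: "r ` {1..k} \<subseteq> {1..t}" "\<And>i. real (card {u \<in> {1..k}. r u = i}) \<le> m"
    and c: "0 \<le> c" and G: "finite G"
    and small: "3 * (2 * real t * (c + 1) * real k) + 3 * (real (card G) * m\<^sup>2) < real k ^ 2 / 2"
  obtains u v w where "u \<in> {1..k}" "v \<in> {1..k}" "w \<in> {1..k}" "u + v + w = k + 2"
    "u \<notin> peripheral p k c" "v \<notin> peripheral q k c" "w \<notin> peripheral r k c"
    "(p u, q v) \<notin> G" "(p u, r w) \<notin> G" "(q v, r w) \<notin> G"
proof -
  define Q where "Q = {(u, v) \<in> {1..k} \<times> {1..k}. u + v \<le> k + 1}"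
  have fQ: "finite Q" unfolding Q_def by (rule finite_subset[of _ "{1..k} \<times> {1..k}"]) auto
  define third where "third = (\<lambda>(u, v). k + 2 - (u + v))"
  have third: "third g \<in> {1..k}" "fst g + snd g + third g = k + 2" if "g \<in> Q" for g
    using that by (auto simp: Q_def third_def)
  have mem: "fst g \<in> {1..k}" "snd g \<in> {1..k}" if "g \<in> Q" for g
    using that by (auto simp: Q_def)
  have bound: "card {g \<in> Q. h g \<in> D} \<le> card D" if "inj_on h Q" "finite D" for h :: "nat \<times> nat \<Rightarrow> nat \<times> nat" and D
    by (rule card_inj_on_le[of h]) (use that in \<open>auto intro: inj_on_subset\<close>)
  \<comment> \<open>The three projections to two coordinates; each bad event below is transported
    along one of them.\<close>
  have i1: "inj_on (\<lambda>g. (fst g, snd g)) Q" by (auto intro: inj_onI)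
  have i2: "inj_on (\<lambda>g. (fst g, third g)) Q"
  proof (rule inj_onI, clarsimp)
    fix a b b' assume g: "(a, b) \<in> Q" "(a, b') \<in> Q" "third (a, b) = third (a, b')"
    show "b = b'" using third(2)[OF g(1)] third(2)[OF g(2)] g(3) by simp
  qed
  have i3: "inj_on (\<lambda>g. (snd g, third g)) Q"
  proof (rule inj_onI, clarsimp)
    fix a a' b assume g: "(a, b) \<in> Q" "(a', b) \<in> Q" "third (a, b) = third (a', b)"
    show "a = a'" using third(2)[OF g(1)] third(2)[OF g(2)] g(3) by simp
  qed
  define B1 where "B1 = {g \<in> Q. fst g \<in> peripheral p k c}"
  define B2 where "B2 = {g \<in> Q. snd g \<in> peripheral q k c}"
  define B3 where "B3 = {g \<in> Q. third g \<in> peripheral r k c}"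
  define B4 where "B4 = {g \<in> Q. (p (fst g), q (snd g)) \<in> G}"
  define B5 where "B5 = {g \<in> Q. (p (fst g), r (third g)) \<in> G}"
  define B6 where "B6 = {g \<in> Q. (q (snd g), r (third g)) \<in> G}"
  have fp: "finite (peripheral s k c)" for s by (simp add: peripheral_def)
  have per: "real (card (peripheral s k c)) * real k \<le> 2 * real t * (c + 1) * real k"
    if "s ` {1..k} \<subseteq> {1..t}" for s
    using card_peripheral[OF that c] by (rule mult_right_mono) simp
  have b1: "real (card B1) \<le> 2 * real t * (c + 1) * real k"
  proof -
    have "B1 = {g \<in> Q. (fst g, snd g) \<in> peripheral p k c \<times> {1..k}}"
      using mem by (auto simp: B1_def)
    then have "card B1 \<le> card (peripheral p k c \<times> {1..k})"
      by (simp only:) (rule bound[OF i1], simp add: fp)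
    then show ?thesis using per[OF p(1)] by (simp add: card_cartesian_product flip: of_nat_mult)
  qed
  have b2: "real (card B2) \<le> 2 * real t * (c + 1) * real k"
  proof -
    have "B2 = {g \<in> Q. (fst g, snd g) \<in> {1..k} \<times> peripheral q k c}"
      using mem by (auto simp: B2_def)
    then have "card B2 \<le> card ({1..k} \<times> peripheral q k c)"
      by (simp only:) (rule bound[OF i1], simp add: fp)
    then show ?thesis using per[OF q(1)] by (simp add: card_cartesian_product mult.commute flip: of_nat_mult)
  qed
  have b3: "real (card B3) \<le> 2 * real t * (c + 1) * real k"
  proof -
    have "B3 = {g \<in> Q. (fst g, third g) \<in> {1..k} \<times> peripheral r k c}"
      using mem by (auto simp: B3_def)
    then have "card B3 \<le> card ({1..k} \<times> peripheral r k c)"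
      by (simp only:) (rule bound[OF i2], simp add: fp)
    then show ?thesis using per[OF r(1)] by (simp add: card_cartesian_product mult.commute flip: of_nat_mult)
  qed
  have b4: "real (card B4) \<le> real (card G) * m\<^sup>2"
  proof -
    let ?D = "{(u, v) \<in> {1..k} \<times> {1..k}. (p u, q v) \<in> G}"
    have "B4 = {g \<in> Q. (fst g, snd g) \<in> ?D}" using mem by (auto simp: B4_def)
    moreover have "finite ?D" by (rule finite_subset[of _ "{1..k} \<times> {1..k}"]) auto
    ultimately have "card B4 \<le> card ?D"
      by (simp only:) (rule bound[OF i1])
    moreover have "real (card ?D) \<le> real (card G) * m\<^sup>2"
      by (rule card_pairs_in_classes[OF G _ _ p(2) q(2)]) auto
    ultimately show ?thesis by linarith
  qed
  have b5: "real (card B5) \<le> real (card G) * m\<^sup>2"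
  proof -
    let ?D = "{(u, v) \<in> {1..k} \<times> {1..k}. (p u, r v) \<in> G}"
    have "B5 = {g \<in> Q. (fst g, third g) \<in> ?D}" using mem third by (auto simp: B5_def)
    moreover have "finite ?D" by (rule finite_subset[of _ "{1..k} \<times> {1..k}"]) auto
    ultimately have "card B5 \<le> card ?D"
      by (simp only:) (rule bound[OF i2])
    moreover have "real (card ?D) \<le> real (card G) * m\<^sup>2"
      by (rule card_pairs_in_classes[OF G _ _ p(2) r(2)]) auto
    ultimately show ?thesis by linarith
  qed
  have b6: "real (card B6) \<le> real (card G) * m\<^sup>2"
  proof -
    let ?D = "{(u, v) \<in> {1..k} \<times> {1..k}. (q u, r v) \<in> G}"
    have "B6 = {g \<in> Q. (snd g, third g) \<in> ?D}" using mem third by (auto simp: B6_def)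
    moreover have "finite ?D" by (rule finite_subset[of _ "{1..k} \<times> {1..k}"]) auto
    ultimately have "card B6 \<le> card ?D"
      by (simp only:) (rule bound[OF i3])
    moreover have "real (card ?D) \<le> real (card G) * m\<^sup>2"
      by (rule card_pairs_in_classes[OF G _ _ q(2) r(2)]) auto
    ultimately show ?thesis by linarith
  qed
  have "card (B1 \<union> B2 \<union> B3 \<union> B4 \<union> B5 \<union> B6) \<le> card B1 + card B2 + card B3 + card B4 + card B5 + card B6"
    using card_Un_le[of B1 B2] card_Un_le[of "B1 \<union> B2" B3] card_Un_le[of "B1 \<union> B2 \<union> B3" B4]
      card_Un_le[of "B1 \<union> B2 \<union> B3 \<union> B4" B5] card_Un_le[of "B1 \<union> B2 \<union> B3 \<union> B4 \<union> B5" B6]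
    by linarith
  then have "real (card (B1 \<union> B2 \<union> B3 \<union> B4 \<union> B5 \<union> B6)) < real (card Q)"
    using b1 b2 b3 b4 b5 b6 small card_triangle_pairs[of k] unfolding Q_def by linarith
  then have "\<not> Q \<subseteq> B1 \<union> B2 \<union> B3 \<union> B4 \<union> B5 \<union> B6"
    using card_mono[of "B1 \<union> B2 \<union> B3 \<union> B4 \<union> B5 \<union> B6" Q] fQ
    by (auto simp: B1_def B2_def B3_def B4_def B5_def B6_def)
  then obtain g where g: "g \<in> Q" "g \<notin> B1 \<union> B2 \<union> B3 \<union> B4 \<union> B5 \<union> B6" by blast
  show ?thesis
    by (rule that[OF mem[OF g(1)] third[OF g(1)]])
      (use g in \<open>simp_all add: B1_def B2_def B3_def B4_def B5_def B6_def\<close>)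
qed

subsection \<open>Triangle counting\<close>

text \<open>A sum of indicators over ordered pairs, so that orders of summation can be exchanged and
  the two vertex classes may have different types.\<close>

definition pair_count :: "('a \<Rightarrow> 'b \<Rightarrow> bool) \<Rightarrow> 'a set \<Rightarrow> 'b set \<Rightarrow> real" where
  "pair_count R X Y = (\<Sum>x\<in>X. \<Sum>y\<in>Y. of_bool (R x y))"

lemma card_filter_eq_sum:
  "finite S \<Longrightarrow> real (card {s \<in> S. P s}) = (\<Sum>s\<in>S. of_bool (P s))"
  by (simp add: Int_def)

lemma pair_count_eq_card:
  assumes "finite X" "finite Y"
  shows "pair_count R X Y = real (card {(x, y) \<in> X \<times> Y. R x y})"
proof -
  have "{(x, y) \<in> X \<times> Y. R x y} = {p \<in> X \<times> Y. R (fst p) (snd p)}"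
    by auto
  moreover have "pair_count R X Y = (\<Sum>p\<in>X \<times> Y. of_bool (R (fst p) (snd p)))"
    by (simp only: pair_count_def sum.cartesian_product case_prod_unfold)
  ultimately show ?thesis
    using card_filter_eq_sum[of "X \<times> Y"] assms by (simp only: finite_cartesian_product)
qed

lemma sum_filter_of_bool:
  fixes f :: "'a \<Rightarrow> real"
  assumes "finite X"
  shows "(\<Sum>x\<in>{x \<in> X. R x}. f x) = (\<Sum>x\<in>X. of_bool (R x) * f x)"
proof -
  have "(\<Sum>x\<in>X. of_bool (R x) * f x) = (\<Sum>x\<in>X. if R x then f x else 0)"
    by (rule sum.cong) auto
  then show ?thesis using assms by (simp add: sum.inter_filter)
qed

text \<open>A one-sided counting lemma that needs only lower bounds on edge counts. For fixed
  \<open>z\<close>, the bound for \<open>R12\<close> is applied to the two neighbourhoods of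
  \<open>z\<close>. The remaining sum counts paths from \<open>x\<close> over \<open>z\<close> to
  \<open>y\<close>; grouped by \<open>y\<close>, it is bounded through \<open>R13\<close> and then
  \<open>R23\<close>. Each of the three applications costs at most \<open>\<epsilon> * n\<close>,
  because the densities multiplying the errors are at most 1.\<close>

lemma triangle_count_ge:
  fixes A :: "'a set" and B :: "'b set" and C :: "'c set" and d12 d13 d23 \<epsilon> :: real
  assumes fin: "finite A" "finite B" "finite C" and sub: "X \<subseteq> A" "Y \<subseteq> B" "Z \<subseteq> C"
    and d: "0 \<le> d12" "d12 \<le> 1" "0 \<le> d13" "d13 \<le> 1" and e: "0 \<le> \<epsilon>"
    and R12: "\<And>X Y. X \<subseteq> A \<Longrightarrow> Y \<subseteq> B \<Longrightarrow>
      pair_count R12 X Y \<ge> d12 * real (card X) * real (card Y) - \<epsilon> * real (card A) * real (card B)"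
    and R13: "\<And>X Z. X \<subseteq> A \<Longrightarrow> Z \<subseteq> C \<Longrightarrow>
      pair_count R13 X Z \<ge> d13 * real (card X) * real (card Z) - \<epsilon> * real (card A) * real (card C)"
    and R23: "\<And>Y Z. Y \<subseteq> B \<Longrightarrow> Z \<subseteq> C \<Longrightarrow>
      pair_count R23 Y Z \<ge> d23 * real (card Y) * real (card Z) - \<epsilon> * real (card B) * real (card C)"
  shows "real (card {(x, y, z) \<in> X \<times> Y \<times> Z. R12 x y \<and> R13 x z \<and> R23 y z}) \<ge>
    d12 * d13 * d23 * real (card X) * real (card Y) * real (card Z)
      - 3 * \<epsilon> * real (card A) * real (card B) * real (card C)"
proof -
  have f: "finite X" "finite Y" "finite Z" using fin sub finite_subset by blast+
  have c: "real (card X) \<le> real (card A)" "real (card Y) \<le> real (card B)" "real (card Z) \<le> real (card C)"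
    using fin sub by (auto intro: card_mono)
  define n where "n = real (card A) * real (card B) * real (card C)"
  have n: "n \<ge> 0" by (simp add: n_def)
  let ?X = "\<lambda>z. {x \<in> X. R13 x z}" and ?Y = "\<lambda>z. {y \<in> Y. R23 y z}" and ?Z = "\<lambda>y. {z \<in> Z. R23 y z}"
  have cX: "real (card (?X z)) = (\<Sum>x\<in>X. of_bool (R13 x z))" for z
    by (rule card_filter_eq_sum) (fact f)
  have cY: "real (card (?Y z)) = (\<Sum>y\<in>Y. of_bool (R23 y z))" for z
    by (rule card_filter_eq_sum) (fact f)
  have cZ: "real (card (?Z y)) = (\<Sum>z\<in>Z. of_bool (R23 y z))" for y
    by (rule card_filter_eq_sum) (fact f)
  let ?P = "\<lambda>p. R12 (fst p) (fst (snd p)) \<and> R13 (fst p) (snd (snd p)) \<and> R23 (fst (snd p)) (snd (snd p))"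
  have "{(x, y, z) \<in> X \<times> Y \<times> Z. R12 x y \<and> R13 x z \<and> R23 y z} = {p \<in> X \<times> Y \<times> Z. ?P p}"
    by auto
  then have "real (card {(x, y, z) \<in> X \<times> Y \<times> Z. R12 x y \<and> R13 x z \<and> R23 y z})
    = (\<Sum>p\<in>X \<times> Y \<times> Z. of_bool (?P p))"
    using card_filter_eq_sum[of "X \<times> Y \<times> Z" ?P] f by (simp only: finite_cartesian_product)
  also have "\<dots> = (\<Sum>x\<in>X. \<Sum>y\<in>Y. \<Sum>z\<in>Z. of_bool (R12 x y \<and> R13 x z \<and> R23 y z))"
    by (simp only: sum.cartesian_product case_prod_unfold)
  also have "\<dots> = (\<Sum>x\<in>X. \<Sum>z\<in>Z. \<Sum>y\<in>Y. of_bool (R12 x y \<and> R13 x z \<and> R23 y z))"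
    by (intro sum.cong refl sum.swap)
  also have "\<dots> = (\<Sum>z\<in>Z. \<Sum>x\<in>X. \<Sum>y\<in>Y. of_bool (R12 x y \<and> R13 x z \<and> R23 y z))"
    by (rule sum.swap)
  also have "\<dots> = (\<Sum>z\<in>Z. pair_count R12 (?X z) (?Y z))"
    by (simp only: pair_count_def sum_filter_of_bool f sum_distrib_left of_bool_conj mult_ac)
  finally have T: "real (card {(x, y, z) \<in> X \<times> Y \<times> Z. R12 x y \<and> R13 x z \<and> R23 y z})
    = (\<Sum>z\<in>Z. pair_count R12 (?X z) (?Y z))" .
  have "(\<Sum>z\<in>Z. d12 * real (card (?X z)) * real (card (?Y z)) - \<epsilon> * real (card A) * real (card B))
      \<le> (\<Sum>z\<in>Z. pair_count R12 (?X z) (?Y z))"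
    by (rule sum_mono, rule R12) (use sub in auto)
  moreover have "(\<Sum>z\<in>Z. \<epsilon> * real (card A) * real (card B)) \<le> \<epsilon> * n"
    using mult_right_mono[OF c(3), of "\<epsilon> * real (card A) * real (card B)"] e by (simp add: n_def mult_ac)
  ultimately have 1: "(\<Sum>z\<in>Z. pair_count R12 (?X z) (?Y z))
      \<ge> d12 * (\<Sum>z\<in>Z. real (card (?X z)) * real (card (?Y z))) - \<epsilon> * n"
    by (simp add: sum_subtractf sum_distrib_left mult_ac)
  \<comment> \<open>Paths with middle vertex \<open>z\<close> are regrouped by their end
    \<open>y\<close>: they are the pairs related by \<open>R13\<close> between \<open>X\<close> and
    the neighbourhood of \<open>y\<close> in \<open>Z\<close>.\<close>
  have "(\<Sum>z\<in>Z. real (card (?X z)) * real (card (?Y z)))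
     = (\<Sum>z\<in>Z. \<Sum>x\<in>X. \<Sum>y\<in>Y. of_bool (R13 x z) * of_bool (R23 y z))"
    by (simp only: cX cY sum_product)
  also have "\<dots> = (\<Sum>z\<in>Z. \<Sum>y\<in>Y. \<Sum>x\<in>X. of_bool (R13 x z) * of_bool (R23 y z))"
    by (intro sum.cong refl sum.swap)
  also have "\<dots> = (\<Sum>y\<in>Y. \<Sum>z\<in>Z. \<Sum>x\<in>X. of_bool (R13 x z) * of_bool (R23 y z))"
    by (rule sum.swap)
  also have "\<dots> = (\<Sum>y\<in>Y. \<Sum>x\<in>X. \<Sum>z\<in>Z. of_bool (R13 x z) * of_bool (R23 y z))"
    by (intro sum.cong refl sum.swap)
  also have "\<dots> = (\<Sum>y\<in>Y. pair_count R13 X (?Z y))"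
    by (simp only: pair_count_def sum_filter_of_bool f mult_ac)
  finally have S: "(\<Sum>z\<in>Z. real (card (?X z)) * real (card (?Y z))) = (\<Sum>y\<in>Y. pair_count R13 X (?Z y))" .
  have "(\<Sum>y\<in>Y. d13 * real (card X) * real (card (?Z y)) - \<epsilon> * real (card A) * real (card C))
      \<le> (\<Sum>y\<in>Y. pair_count R13 X (?Z y))"
    by (rule sum_mono, rule R13) (use sub in auto)
  moreover have "(\<Sum>y\<in>Y. \<epsilon> * real (card A) * real (card C)) \<le> \<epsilon> * n"
    using mult_right_mono[OF c(2), of "\<epsilon> * real (card A) * real (card C)"] e by (simp add: n_def mult_ac)
  moreover have "(\<Sum>y\<in>Y. real (card (?Z y))) = pair_count R23 Y Z"
    by (simp only: cZ pair_count_def)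
  ultimately have 2: "(\<Sum>y\<in>Y. pair_count R13 X (?Z y)) \<ge> d13 * real (card X) * pair_count R23 Y Z - \<epsilon> * n"
    by (simp add: sum_subtractf flip: sum_distrib_left)
  have "d13 * real (card X) * pair_count R23 Y Z \<ge>
     d13 * real (card X) * (d23 * real (card Y) * real (card Z) - \<epsilon> * real (card B) * real (card C))"
    by (rule mult_left_mono[OF R23]) (use sub d in auto)
  moreover have "d13 * real (card X) * (\<epsilon> * real (card B) * real (card C)) \<le> 1 * real (card A) * (\<epsilon> * real (card B) * real (card C))"
    by (intro mult_right_mono mult_mono) (use c d e in auto)
  ultimately have 3: "d13 * real (card X) * pair_count R23 Y Z \<ge> d13 * d23 * real (card X) * real (card Y) * real (card Z) - \<epsilon> * n"
    by (simp add: n_def algebra_simps)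
  have "d12 * (\<Sum>y\<in>Y. pair_count R13 X (?Z y)) \<ge>
      d12 * (d13 * d23 * real (card X) * real (card Y) * real (card Z) - 2 * (\<epsilon> * n))"
    by (rule mult_left_mono) (use 2 3 d in auto)
  moreover have "d12 * (2 * (\<epsilon> * n)) \<le> 1 * (2 * (\<epsilon> * n))"
    by (rule mult_right_mono) (use d e n in auto)
  ultimately show ?thesis
    using 1 unfolding T S n_def by (simp add: algebra_simps)
qed


section \<open>Edges and triangles as sets, counted through ordered tuples\<close>

lemma card_K2_restrict:
  assumes "U \<inter> W = {}" "X \<subseteq> U" "Y \<subseteq> W"
  shows "card (E \<inter> K2 X Y) = card {(x, y) \<in> X \<times> Y. {x, y} \<in> E}"
proof -
  have "bij_betw (\<lambda>(x, y). {x, y}) {(x, y) \<in> X \<times> Y. {x, y} \<in> E} (E \<inter> K2 X Y)"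
    unfolding bij_betw_def
  proof
    show "inj_on (\<lambda>(x, y). {x, y}) {(x, y) \<in> X \<times> Y. {x, y} \<in> E}"
    proof (rule inj_onI, clarsimp)
      fix x y x' y' assume "x \<in> X" "y \<in> Y" "x' \<in> X" "y' \<in> Y" "{x, y} = {x', y'}"
      moreover from this have "x \<noteq> y'" using assms by blast
      ultimately show "x = x' \<and> y = y'" by (simp add: doubleton_eq_iff)
    qed
    show "(\<lambda>(x, y). {x, y}) ` {(x, y) \<in> X \<times> Y. {x, y} \<in> E} = E \<inter> K2 X Y"
    proof (intro equalityI subsetI)
      fix e assume "e \<in> (\<lambda>(x, y). {x, y}) ` {(x, y) \<in> X \<times> Y. {x, y} \<in> E}"
      then obtain x y where "x \<in> X" "y \<in> Y" "{x, y} \<in> E" "e = {x, y}" by auto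
      moreover from this have "x \<noteq> y" using assms by blast
      ultimately show "e \<in> E \<inter> K2 X Y" unfolding K2_def by blast
    next
      fix e assume "e \<in> E \<inter> K2 X Y"
      then obtain x y where "x \<in> X" "y \<in> Y" "{x, y} \<in> E" "e = {x, y}"
        unfolding K2_def by blast
      then show "e \<in> (\<lambda>(x, y). {x, y}) ` {(x, y) \<in> X \<times> Y. {x, y} \<in> E}"
        by (intro image_eqI[of _ _ "(x, y)"]) simp_all
    qed
  qed
  then show ?thesis by (rule bij_betw_same_card[symmetric])
qed

lemma card_K2:
  assumes "U \<inter> W = {}"
  shows "card (K2 U W) = card U * card W"
proof -
  have "{(x, y) \<in> U \<times> W. {x, y} \<in> UNIV} = U \<times> W" by auto
  then show ?thesis
    using card_K2_restrict[OF assms order_refl order_refl, of UNIV] by (simp add: card_cartesian_product)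
qed

text \<open>Two densities are involved: the true density \<open>d\<close>, bounded below by
  \<open>dense\<close>, and the prescribed \<open>d'\<close>. The estimate
  \<open>d' \<le> d + \<epsilon>\<close> is kept because the error allowed in \<open>disc23\<close>
  is measured by the prescribed density.\<close>

lemma disc2_densD:
  assumes D: "disc2_dens \<epsilon> d' U W E" and fin: "finite U" "finite W"
    and ne: "U \<noteq> {}" "W \<noteq> {}"
    and dense: "real (card U) * real (card W) \<le> l * real (card E)" and l: "0 < l"
  obtains d where "1 / l \<le> d" "d \<le> 1" "d' \<le> d + \<epsilon>"
    "\<And>X Y. X \<subseteq> U \<Longrightarrow> Y \<subseteq> W \<Longrightarrow> pair_count (\<lambda>x y. {x, y} \<in> E) X Y \<ge>
       d * real (card X) * real (card Y) - \<epsilon> * real (card U) * real (card W)"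
proof -
  define n where "n = real (card U) * real (card W)"
  have n: "n > 0" using fin ne by (simp add: n_def card_gt_0_iff)
  have bip: "U \<inter> W = {}" "E \<subseteq> K2 U W"
    using D by (auto simp only: disc2_dens_def disc2_def bipartite_graph_def)
  obtain d where d_eq: "real (card E) = d * real (card U) * real (card W)"
    and d_disc: "\<forall>U' W'. U' \<subseteq> U \<and> W' \<subseteq> W \<longrightarrow>
      \<bar>real (card (E \<inter> K2 U' W')) - d * real (card U') * real (card W')\<bar> \<le> \<epsilon> * real (card U) * real (card W)"
    using D unfolding disc2_dens_def disc2_def by (elim conjE exE)
  have "\<bar>real (card E) - d' * real (card U) * real (card W)\<bar> \<le> \<epsilon> * real (card U) * real (card W)"
    using D unfolding disc2_dens_def by (elim conjE)
  then have d': "\<bar>real (card E) - d' * n\<bar> \<le> \<epsilon> * n" by (simp only: n_def mult.assoc)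
  have d: "real (card E) = d * n" using d_eq by (simp only: n_def mult.assoc)
  have "n * 1 \<le> n * (l * d)" using dense unfolding d n_def[symmetric] by (simp add: mult_ac)
  then have "1 \<le> l * d" using n mult_le_cancel_left_pos by blast
  then have 1: "1 / l \<le> d" using l by (simp add: field_simps)
  have fK: "finite (K2 U W)"
    by (rule finite_subset[of _ "Pow (U \<union> W)"]) (use fin in \<open>auto simp: K2_def\<close>)
  have "card E \<le> card U * card W"
    using card_mono[OF fK bip(2)] card_K2[OF bip(1)] by simp
  then have "real (card E) \<le> real (card U * card W)" by (simp only: of_nat_le_iff)
  then have "d * n \<le> 1 * n" unfolding d by (simp add: n_def)
  then have 2: "d \<le> 1" using n mult_le_cancel_right_pos by blast
  have "d' * n \<le> (d + \<epsilon>) * n" using d d' unfolding distrib_right by linarith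
  then have 3: "d' \<le> d + \<epsilon>" using n mult_le_cancel_right_pos by blast
  show ?thesis
  proof (rule that[OF 1 2 3])
    fix X Y assume XY: "X \<subseteq> U" "Y \<subseteq> W"
    then have "finite X" "finite Y" using fin finite_subset by blast+
    then have "pair_count (\<lambda>x y. {x, y} \<in> E) X Y = real (card (E \<inter> K2 X Y))"
      unfolding card_K2_restrict[OF bip(1) XY] by (rule pair_count_eq_card)
    then show "pair_count (\<lambda>x y. {x, y} \<in> E) X Y \<ge>
       d * real (card X) * real (card Y) - \<epsilon> * real (card U) * real (card W)"
      using d_disc[rule_format, OF conjI[OF XY]] by linarith
  qed
qed

text \<open>The complete tripartite graph on \<open>X\<close>, \<open>Y\<close>, \<open>Z\<close>;
  intersected with a graph it gives the subgraph on which discrepancy is tested.\<close>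

definition box :: "'a set \<Rightarrow> 'a set \<Rightarrow> 'a set \<Rightarrow> 'a set set" where
  "box X Y Z = K2 X Y \<union> K2 X Z \<union> K2 Y Z"

text \<open>Edges of a box join different parts, so three pairwise adjacent vertices occupy all
  three parts.\<close>

lemma K3_box_cases:
  assumes "A \<inter> B = {}" "A \<inter> C = {}" "B \<inter> C = {}" "X \<subseteq> A" "Y \<subseteq> B" "Z \<subseteq> C"
    and e: "e \<in> K3 (E \<inter> box X Y Z)"
  obtains x y z where "x \<in> X" "y \<in> Y" "z \<in> Z" "e = {x, y, z}"
proof -
  obtain a b c where e: "e = {a, b, c}" and
    ab: "a \<noteq> b" "{a, b} \<in> box X Y Z" and ac: "a \<noteq> c" "{a, c} \<in> box X Y Z"
    and bc: "b \<noteq> c" "{b, c} \<in> box X Y Z"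
    using e unfolding K3_def by auto
  \<comment> \<open>The default value 2 also covers vertices outside \<open>C\<close>; this is
    harmless, as only vertices of \<open>X\<close>, \<open>Y\<close>, \<open>Z\<close> are
    classified.\<close>
  define part where "part v = (if v \<in> A then 0 else if v \<in> B then 1 else 2 :: nat)" for v
  have pX: "v \<in> X \<Longrightarrow> part v = 0" and pY: "v \<in> Y \<Longrightarrow> part v = 1" and pZ: "v \<in> Z \<Longrightarrow> part v = 2" for v
    using assms by (auto simp: part_def)
  have *: "part v \<noteq> part w \<and> v \<in> X \<union> Y \<union> Z \<and> w \<in> X \<union> Y \<union> Z" if vw: "{v, w} \<in> box X Y Z" for v w
  proof -
    obtain p q where "{v, w} = {p, q}" and "p \<in> X \<and> q \<in> Y \<or> p \<in> X \<and> q \<in> Z \<or> p \<in> Y \<and> q \<in> Z"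
      using vw unfolding box_def K2_def by blast
    then show ?thesis
      unfolding doubleton_eq_iff by (elim disjE conjE) (simp_all add: pX pY pZ)
  qed
  have u: "v \<in> X \<and> part v = 0 \<or> v \<in> Y \<and> part v = 1 \<or> v \<in> Z \<and> part v = 2" if "v \<in> X \<union> Y \<union> Z" for v
    using that pX pY pZ by auto
  have p: "part a \<noteq> part b" "part a \<noteq> part c" "part b \<noteq> part c" "a \<in> X \<union> Y \<union> Z" "b \<in> X \<union> Y \<union> Z" "c \<in> X \<union> Y \<union> Z"
    using *[OF ab(2)] *[OF ac(2)] *[OF bc(2)] by auto
  have "a \<in> X \<and> b \<in> Y \<and> c \<in> Z \<or> a \<in> X \<and> b \<in> Z \<and> c \<in> Y \<or> a \<in> Y \<and> b \<in> X \<and> c \<in> Z \<or>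
    a \<in> Y \<and> b \<in> Z \<and> c \<in> X \<or> a \<in> Z \<and> b \<in> X \<and> c \<in> Y \<or> a \<in> Z \<and> b \<in> Y \<and> c \<in> X"
    using u[OF p(4)] u[OF p(5)] u[OF p(6)] p(1-3) by (elim disjE conjE) simp_all
  moreover have "e = {a, c, b}" "e = {b, a, c}" "e = {b, c, a}" "e = {c, a, b}" "e = {c, b, a}"
    unfolding e by (simp_all add: insert_commute)
  ultimately show ?thesis using e that by metis
qed

text \<open>A transversal triple is recovered from its vertex set by intersecting with
  \<open>A\<close>, \<open>B\<close> and \<open>C\<close>, so distinct triples give distinct
  triangles.\<close>

lemma card_K3_box_ge:
  assumes "A \<inter> B = {}" "A \<inter> C = {}" "B \<inter> C = {}" "X \<subseteq> A" "Y \<subseteq> B" "Z \<subseteq> C"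
    and fin: "finite A" "finite B" "finite C"
  shows "card {(x, y, z) \<in> X \<times> Y \<times> Z. {x, y} \<in> E \<inter> K2 A B \<and> {x, z} \<in> E \<inter> K2 A C \<and> {y, z} \<in> E \<inter> K2 B C}
    \<le> card (K3 (E \<inter> box X Y Z))" (is "card ?T \<le> _")
proof (rule card_inj_on_le[of "\<lambda>(x, y, z). {x, y, z}"])
  show "inj_on (\<lambda>(x, y, z). {x, y, z}) ?T"
  proof (rule inj_onI, clarsimp)
    fix x y z x' y' z'
    assume m: "x \<in> X" "y \<in> Y" "z \<in> Z" "x' \<in> X" "y' \<in> Y" "z' \<in> Z" "{x, y, z} = {x', y', z'}"
    have A: "{x, y, z} \<inter> A = {x}" and B: "{x, y, z} \<inter> B = {y}" and C: "{x, y, z} \<inter> C = {z}"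
      if "x \<in> X" "y \<in> Y" "z \<in> Z" for x y z
    proof -
      have "x \<in> A" "y \<in> B" "z \<in> C" using that assms(4-6) by blast+
      moreover from this have "x \<notin> B" "x \<notin> C" "y \<notin> A" "y \<notin> C" "z \<notin> A" "z \<notin> B"
        using assms(1-3) by blast+
      ultimately show "{x, y, z} \<inter> A = {x}" "{x, y, z} \<inter> B = {y}" "{x, y, z} \<inter> C = {z}"
        by simp_all
    qed
    have "{x} = {x'}" using A[OF m(1-3)] A[OF m(4-6)] m(7) by simp
    moreover have "{y} = {y'}" using B[OF m(1-3)] B[OF m(4-6)] m(7) by simp
    moreover have "{z} = {z'}" using C[OF m(1-3)] C[OF m(4-6)] m(7) by simp
    ultimately show "x = x' \<and> y = y' \<and> z = z'" by simp
  qed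
  show "(\<lambda>(x, y, z). {x, y, z}) ` ?T \<subseteq> K3 (E \<inter> box X Y Z)"
  proof clarsimp
    fix x y z
    assume m: "x \<in> X" "y \<in> Y" "z \<in> Z" "{x, y} \<in> E" "{x, z} \<in> E" "{y, z} \<in> E"
    have ne: "x \<noteq> y" "x \<noteq> z" "y \<noteq> z" using m(1-3) assms(1-6) by blast+
    have "{x, y} \<in> K2 X Y" unfolding K2_def using m ne by blast
    moreover have "{x, z} \<in> K2 X Z" unfolding K2_def using m ne by blast
    moreover have "{y, z} \<in> K2 Y Z" unfolding K2_def using m ne by blast
    ultimately have "{x, y} \<in> E \<inter> box X Y Z" "{x, z} \<in> E \<inter> box X Y Z" "{y, z} \<in> E \<inter> box X Y Z"
      using m by (simp_all add: box_def)
    then show "{x, y, z} \<in> K3 (E \<inter> box X Y Z)"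
      using ne unfolding K3_def by blast
  qed
  have "K3 (E \<inter> box X Y Z) \<subseteq> Pow (A \<union> B \<union> C)"
  proof
    fix e assume "e \<in> K3 (E \<inter> box X Y Z)"
    then obtain x y z where "x \<in> X" "y \<in> Y" "z \<in> Z" "e = {x, y, z}"
      by (rule K3_box_cases[OF assms(1-6)])
    then show "e \<in> Pow (A \<union> B \<union> C)" using assms(4-6) by auto
  qed
  moreover have "finite (Pow (A \<union> B \<union> C))" using fin by simp
  ultimately show "finite (K3 (E \<inter> box X Y Z))" by (rule finite_subset)
qed

text \<open>Both boxes contain at least \<open>M\<close> triangles, while the discrepancy error is
  at most \<open>M / 4\<close>. The box without edges gives
  \<open>\<bar>d3\<bar> \<le> 1 / 4\<close> and the full box gives
  \<open>\<bar>1 - d3\<bar> \<le> 1 / 4\<close>, which is impossible.\<close>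

lemma disc23_contradiction:
  fixes l \<delta> \<epsilon>1 \<epsilon>2 :: real
  assumes D: "disc23 \<epsilon>1 \<epsilon>2 A B C E F" and fin: "finite A" "finite B" "finite C"
    and ne: "A \<noteq> {}" "B \<noteq> {}" "C \<noteq> {}"
    and dense: "real (card A) * real (card B) \<le> l * real (card (E \<inter> K2 A B))"
      "real (card A) * real (card C) \<le> l * real (card (E \<inter> K2 A C))"
      "real (card B) * real (card C) \<le> l * real (card (E \<inter> K2 B C))"
    and l: "1 \<le> l" and \<delta>: "0 < \<delta>" "\<delta> \<le> 1" and \<epsilon>1: "0 \<le> \<epsilon>1" "\<epsilon>1 \<le> \<delta> ^ 3 / 64"
    and \<epsilon>2: "0 \<le> \<epsilon>2" "\<epsilon>2 \<le> \<delta> ^ 3 / (6 * l ^ 3)"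
    and X: "X \<subseteq> A" "\<delta> * real (card A) \<le> real (card X)"
    and Y: "Y \<subseteq> B" "\<delta> * real (card B) \<le> real (card Y)"
    and Z: "Z \<subseteq> C" "\<delta> * real (card C) \<le> real (card Z)"
    and X': "X' \<subseteq> A" "\<delta> * real (card A) \<le> real (card X')"
    and Y': "Y' \<subseteq> B" "\<delta> * real (card B) \<le> real (card Y')"
    and Z': "Z' \<subseteq> C" "\<delta> * real (card C) \<le> real (card Z')"
    and non: "\<And>x y z. x \<in> X \<Longrightarrow> y \<in> Y \<Longrightarrow> z \<in> Z \<Longrightarrow> {x, y, z} \<notin> F"
    and yes: "\<And>x y z. x \<in> X' \<Longrightarrow> y \<in> Y' \<Longrightarrow> z \<in> Z' \<Longrightarrow> {x, y, z} \<in> K3 E \<Longrightarrow> {x, y, z} \<in> F"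
  shows False
proof -
  obtain d3 d2 where tri: "tripartite_graph A B C E" and FE: "F \<subseteq> K3 E" and d2: "0 < d2"
    and D12: "disc2_dens \<epsilon>2 d2 A B (E \<inter> K2 A B)" and D13: "disc2_dens \<epsilon>2 d2 A C (E \<inter> K2 A C)"
    and D23: "disc2_dens \<epsilon>2 d2 B C (E \<inter> K2 B C)"
    and disc: "\<And>E'. E' \<subseteq> E \<Longrightarrow> \<bar>real (card (F \<inter> K3 E')) - d3 * real (card (K3 E'))\<bar>
       \<le> \<epsilon>1 * d2 ^ 3 * real (card A) * real (card B) * real (card C)"
    using D unfolding disc23_def by blast
  have disj: "A \<inter> B = {}" "A \<inter> C = {}" "B \<inter> C = {}" using tri by (auto simp: tripartite_graph_def)
  have l0: "0 < l" using l by simp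
  obtain d12 where d12: "1 / l \<le> d12" "d12 \<le> 1" "d2 \<le> d12 + \<epsilon>2"
    and P12: "\<And>X Y. X \<subseteq> A \<Longrightarrow> Y \<subseteq> B \<Longrightarrow> pair_count (\<lambda>x y. {x, y} \<in> E \<inter> K2 A B) X Y \<ge>
       d12 * real (card X) * real (card Y) - \<epsilon>2 * real (card A) * real (card B)"
    using disc2_densD[OF D12 fin(1,2) ne(1,2) dense(1) l0] by blast
  obtain d13 where d13: "1 / l \<le> d13" "d13 \<le> 1" "d2 \<le> d13 + \<epsilon>2"
    and P13: "\<And>X Y. X \<subseteq> A \<Longrightarrow> Y \<subseteq> C \<Longrightarrow> pair_count (\<lambda>x y. {x, y} \<in> E \<inter> K2 A C) X Y \<ge>
       d13 * real (card X) * real (card Y) - \<epsilon>2 * real (card A) * real (card C)"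
    using disc2_densD[OF D13 fin(1,3) ne(1,3) dense(2) l0] by blast
  obtain d23 where d23: "1 / l \<le> d23" "d23 \<le> 1" "d2 \<le> d23 + \<epsilon>2"
    and P23: "\<And>X Y. X \<subseteq> B \<Longrightarrow> Y \<subseteq> C \<Longrightarrow> pair_count (\<lambda>x y. {x, y} \<in> E \<inter> K2 B C) X Y \<ge>
       d23 * real (card X) * real (card Y) - \<epsilon>2 * real (card B) * real (card C)"
    using disc2_densD[OF D23 fin(2,3) ne(2,3) dense(3) l0] by blast
  define d where "d = d12 * d13 * d23"
  define n where "n = real (card A) * real (card B) * real (card C)"
  have n: "0 < n" using fin ne by (simp add: n_def card_gt_0_iff)
  have il: "0 < 1 / l" using l0 by simp
  have pos: "0 < d12" "0 < d13" "0 < d23" using d12 d13 d23 il by linarith+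
  have d: "0 < d" using pos by (simp add: d_def)
  have "1 / l * (1 / l) * (1 / l) \<le> d"
    unfolding d_def by (intro mult_mono) (use d12 d13 d23 il pos in auto)
  then have ld: "1 / l ^ 3 \<le> d" by (simp add: power3_eq_cube)
  \<comment> \<open>The denominator \<open>6 * l ^ 3\<close> makes the three errors of the counting
    lemma at most half of its main term, since \<open>d\<close> is at least
    \<open>1 / l ^ 3\<close>.\<close>
  have "\<epsilon>2 \<le> \<delta> ^ 3 * (1 / l ^ 3) / 6" using \<epsilon>2 by simp
  also have "\<dots> \<le> \<delta> ^ 3 * d / 6"
    using mult_left_mono[OF ld, of "\<delta> ^ 3"] \<delta> by simp
  finally have e2d: "3 * \<epsilon>2 \<le> \<delta> ^ 3 * d / 2" by simp
  \<comment> \<open>The density \<open>d2\<close> comes from \<open>disc23\<close> and is tied to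
    the true densities only up to \<open>\<epsilon>2\<close>. As
    \<open>\<epsilon>2 \<le> 1 / l\<close>, it is at most twice each of them.\<close>
  have "\<delta> ^ 3 \<le> 1" using \<delta> by (simp add: power_le_one)
  moreover have "l \<le> 6 * l ^ 3" using power_increasing[of 1 3 l] l by simp
  ultimately have "\<delta> ^ 3 / (6 * l ^ 3) \<le> 1 / l"
    using l0 by (intro frac_le) auto
  then have "\<epsilon>2 \<le> 1 / l" using \<epsilon>2 by linarith
  then have "d2 \<le> 2 * d12" "d2 \<le> 2 * d13" "d2 \<le> 2 * d23"
    using d12 d13 d23 by linarith+
  then have "d2 * d2 * d2 \<le> (2 * d12) * (2 * d13) * (2 * d23)"
    using d2 pos by (intro mult_mono) auto
  then have d2d: "d2 ^ 3 \<le> 8 * d" by (simp add: d_def power3_eq_cube)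
  \<comment> \<open>Half of the main term in the triangle count of a box with parts of relative size
    \<open>\<delta>\<close>.\<close>
  define M where "M = \<delta> ^ 3 * d * n / 2"
  have M: "0 < M" using \<delta> d n by (simp add: M_def)
  \<comment> \<open>The constant 64 is 8 times 8: one factor absorbs
    \<open>d2 ^ 3 \<le> 8 * d\<close>, the other leaves \<open>\<delta> ^ 3 * d * n / 8\<close>,
    which is \<open>M / 4\<close>.\<close>
  have err: "\<epsilon>1 * d2 ^ 3 * real (card A) * real (card B) * real (card C) \<le> M / 4"
  proof -
    have "\<epsilon>1 * d2 ^ 3 \<le> (\<delta> ^ 3 / 64) * (8 * d)"
      using \<epsilon>1 d2d d2 \<delta> by (intro mult_mono) auto
    then have "\<epsilon>1 * d2 ^ 3 * n \<le> (\<delta> ^ 3 / 64) * (8 * d) * n"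
      using n by (intro mult_right_mono) auto
    then show ?thesis by (simp add: n_def M_def mult_ac)
  qed
  have K: "real (card (K3 (E \<inter> box X Y Z))) \<ge> M"
    if X: "X \<subseteq> A" "\<delta> * real (card A) \<le> real (card X)"
      and Y: "Y \<subseteq> B" "\<delta> * real (card B) \<le> real (card Y)"
      and Z: "Z \<subseteq> C" "\<delta> * real (card C) \<le> real (card Z)" for X Y Z
  proof -
    have "(\<delta> * real (card A)) * (\<delta> * real (card B)) * (\<delta> * real (card C))
        \<le> real (card X) * real (card Y) * real (card Z)"
      using X Y Z \<delta> by (intro mult_mono) auto
    then have "d * (\<delta> ^ 3 * n) \<le> d * (real (card X) * real (card Y) * real (card Z))"
      using d by (intro mult_left_mono) (auto simp: n_def power3_eq_cube mult_ac)
    moreover have "3 * \<epsilon>2 * n \<le> \<delta> ^ 3 * d / 2 * n" using e2d n by (intro mult_right_mono) auto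
    moreover note triangle_count_ge[OF fin X(1) Y(1) Z(1) less_imp_le[OF pos(1)] d12(2)
      less_imp_le[OF pos(2)] d13(2) \<epsilon>2(1) P12 P13 P23, folded d_def]
    ultimately show ?thesis
      using card_K3_box_ge[OF disj X(1) Y(1) Z(1) fin, of E]
      by (simp add: n_def M_def mult_ac)
  qed
  let ?T = "K3 (E \<inter> box X Y Z)" and ?T' = "K3 (E \<inter> box X' Y' Z')"
  have "F \<inter> ?T = {}"
    using non K3_box_cases[OF disj X(1) Y(1) Z(1)] by blast
  then have "\<bar>d3\<bar> * real (card ?T) \<le> M / 4"
    using disc[of "E \<inter> box X Y Z"] err by (simp add: abs_mult)
  moreover have "\<bar>d3\<bar> * M \<le> \<bar>d3\<bar> * real (card ?T)"
    by (intro mult_left_mono K X Y Z) auto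
  ultimately have a: "\<bar>d3\<bar> * M \<le> (1 / 4) * M" by linarith
  have "?T' \<subseteq> F"
  proof
    fix e assume e: "e \<in> ?T'"
    then obtain x y z where "x \<in> X'" "y \<in> Y'" "z \<in> Z'" "e = {x, y, z}"
      using K3_box_cases[OF disj X'(1) Y'(1) Z'(1)] by blast
    moreover have "e \<in> K3 E" using e unfolding K3_def by blast
    ultimately show "e \<in> F" using yes by blast
  qed
  then have "F \<inter> ?T' = ?T'" by blast
  then have "\<bar>real (card ?T') - d3 * real (card ?T')\<bar> \<le> M / 4"
    using disc[of "E \<inter> box X' Y' Z'"] err by simp
  moreover have "real (card ?T') - d3 * real (card ?T') = (1 - d3) * real (card ?T')"
    by (simp add: algebra_simps)
  ultimately have "\<bar>1 - d3\<bar> * real (card ?T') \<le> M / 4"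
    by (simp add: abs_mult)
  moreover have "\<bar>1 - d3\<bar> * M \<le> \<bar>1 - d3\<bar> * real (card ?T')"
    by (intro mult_left_mono K X' Y' Z') auto
  ultimately have b: "\<bar>1 - d3\<bar> * M \<le> (1 / 4) * M" by linarith
  have "\<bar>d3\<bar> \<le> 1 / 4" "\<bar>1 - d3\<bar> \<le> 1 / 4"
    using a b M mult_le_cancel_right_pos by blast+
  then show False by linarith
qed

subsection \<open>Decompositions of hyperplane configurations\<close>

text \<open>Some pair classes of a decomposition may be sparse or empty; averaging supplies one of
  density at least \<open>1 / l\<close>.\<close>

lemma exists_dense_class:
  fixes P :: "nat \<Rightarrow> 'b set"
  assumes l: "1 \<le> l" and un: "(\<Union>\<alpha>\<in>{1..l}. P \<alpha>) = K"
  shows "\<exists>\<alpha>\<in>{1..l}. real (card K) \<le> real l * real (card (P \<alpha>))"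
proof (rule ccontr)
  assume "\<not> ?thesis"
  then have "(\<Sum>\<alpha>\<in>{1..l}. real l * real (card (P \<alpha>))) < (\<Sum>\<alpha>\<in>{1..l}. real (card K))"
    using l by (intro sum_strict_mono) (auto simp: not_le)
  then have "real l * (\<Sum>\<alpha>\<in>{1..l}. real (card (P \<alpha>))) < real l * real (card K)"
    by (simp flip: sum_distrib_left)
  then have "(\<Sum>\<alpha>\<in>{1..l}. real (card (P \<alpha>))) < real (card K)"
    using l by simp
  moreover have "card K \<le> (\<Sum>\<alpha>\<in>{1..l}. card (P \<alpha>))"
    unfolding un[symmetric] by (rule card_UN_le) simp
  ultimately show False by (simp flip: of_nat_sum)
qed

text \<open>The diagonal contributes \<open>t\<close>, and every member of \<open>\<Gamma>\<close>
  at most two orientations, told apart by the Boolean \<open>i < j\<close>.\<close>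

lemma card_related_pairs:
  fixes \<Gamma> :: "nat set set"
  assumes "finite \<Gamma>"
  shows "card {(i, j) \<in> {1..t} \<times> {1..t}. i = j \<or> {i, j} \<in> \<Gamma>} \<le> t + 2 * card \<Gamma>"
proof -
  let ?G = "{(i, j) \<in> {1..t} \<times> {1..t}. i \<noteq> j \<and> {i, j} \<in> \<Gamma>}"
  let ?D = "(\<lambda>i. (i, i)) ` {1..t}"
  have "card ?G \<le> card (\<Gamma> \<times> (UNIV :: bool set))"
  proof (rule card_inj_on_le[of "\<lambda>(i, j). ({i, j}, i < j)"])
    show "inj_on (\<lambda>(i, j). ({i, j}, i < j)) ?G"
    proof (rule inj_onI, clarsimp)
      fix i j i' j' :: nat
      assume "{i, j} = {i', j'}" "(i < j) = (i' < j')" "i \<noteq> j"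
      then show "i = i' \<and> j = j'" unfolding doubleton_eq_iff by auto
    qed
  qed (use assms in auto)
  moreover have "finite ?G" by (rule finite_subset[of _ "{1..t} \<times> {1..t}"]) auto
  then have "card {(i, j) \<in> {1..t} \<times> {1..t}. i = j \<or> {i, j} \<in> \<Gamma>} \<le> card (?D \<union> ?G)"
    by (intro card_mono) auto
  moreover have "card (?D \<union> ?G) \<le> card ?D + card ?G" by (rule card_Un_le)
  moreover have "card ?D \<le> t" using card_image_le[of "{1..t}" "\<lambda>i. (i, i)"] by simp
  ultimately show ?thesis by (simp add: card_cartesian_product)
qed

theorem theorem2p55:
  fixes \<H> :: "'a hypergraph set"
  assumes "hereditary_property \<H>"
    and "HOP2 \<H>"
  shows "\<not> admits_binary_disc23_error \<H>"
proof

  \<comment> \<open>Parameters and a large hyperplane configuration\<close>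
  assume admits: "admits_binary_disc23_error \<H>"
  \<comment> \<open>\<open>\<delta>\<close> and the lower bound 1000 for \<open>t\<close> are chosen to validate the inequality \<open>small\<close> below.\<close>
  define \<delta> :: real where "\<delta> = 1 / 400"
  \<comment> \<open>The value demanded by \<open>disc23_contradiction\<close>; it also bounds the
    size of \<open>\<Gamma>\<close>, far more tightly than the count of bad solutions
    requires.\<close>
  define \<epsilon>1 where "\<epsilon>1 = \<delta> ^ 3 / 64"
  \<comment> \<open>The shift by 1 keeps \<open>\<epsilon>2 0\<close> positive, where division by
    zero would return 0; it only strengthens the bound needed for \<open>l\<close>.\<close>
  define \<epsilon>2 where "\<epsilon>2 n = \<delta> ^ 3 / (6 * (real n + 1) ^ 3)" for n :: nat
  have "0 < \<epsilon>2 n \<and> \<epsilon>2 n \<le> 1" for n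
  proof -
    have "0 < \<delta> ^ 3 / (6 * b) \<and> \<delta> ^ 3 / (6 * b) \<le> 1" if "1 \<le> b" for b
      using that by (simp add: \<delta>_def divide_simps)
    then show ?thesis unfolding \<epsilon>2_def by (simp add: one_le_power)
  qed
  moreover have "0 < \<epsilon>1" by (simp add: \<epsilon>1_def \<delta>_def)
  ultimately obtain N T L :: nat where
    NTL: "\<forall>(V, F)\<in>\<H>. card V \<ge> N \<longrightarrow>
           (\<exists>t l A P \<Gamma>.
              1000 \<le> t \<and> t \<le> T \<and> 1 \<le> l \<and> l \<le> L \<and>
              decomposition t l \<epsilon>1 (\<epsilon>2 l) V A P \<and>
              \<Gamma> \<subseteq> nsets {1..t} 2 \<and> real (card \<Gamma>) \<le> \<epsilon>1 * real t ^ 2 \<and>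
              (\<forall>i j k. \<forall>\<alpha>\<in>{1..l}. \<forall>\<beta>\<in>{1..l}. \<forall>\<gamma>\<in>{1..l}.
                 distinct_in t i j k \<and> {i, j} \<notin> \<Gamma> \<and> {i, k} \<notin> \<Gamma> \<and> {j, k} \<notin> \<Gamma> \<longrightarrow>
                 disc23 \<epsilon>1 (\<epsilon>2 l) (A i) (A j) (A k) (triad P i j k \<alpha> \<beta> \<gamma>)
                   (F \<inter> K3 (triad P i j k \<alpha> \<beta> \<gamma>))))"
    using admits[unfolded admits_binary_disc23_error_def, rule_format, of 1000 1 \<epsilon>1 \<epsilon>2] by auto
  \<comment> \<open>\<open>N\<close> makes \<open>V\<close> large enough, and \<open>100 * T\<close>
    makes \<open>k\<close> at least \<open>100 * t\<close>, so that the additive 1 in class sizes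
    and in \<open>c + 1\<close> is negligible.\<close>
  define k where "k = N + 100 * T + 1"
  have "1 \<le> k" by (simp add: k_def)
  then obtain V F and x y z :: "nat \<Rightarrow> 'a" where VF: "(V, F) \<in> \<H>"
    and V: "V = x ` {1..k} \<union> y ` {1..k} \<union> z ` {1..k}"
    and inj: "inj_on x {1..k}" "inj_on y {1..k}" "inj_on z {1..k}"
    and disj: "x ` {1..k} \<inter> y ` {1..k} = {}" "x ` {1..k} \<inter> z ` {1..k} = {}" "y ` {1..k} \<inter> z ` {1..k} = {}"
    and edge: "\<And>u v w. u \<in> {1..k} \<Longrightarrow> v \<in> {1..k} \<Longrightarrow> w \<in> {1..k} \<Longrightarrow>
       {x u, y v, z w} \<in> F \<longleftrightarrow> k + 2 \<le> u + v + w"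
    by (rule hyperplane_representation[OF assms]) (rule that; assumption)
  have fV: "finite V" by (simp add: V)
  have "(x ` {1..k} \<union> y ` {1..k}) \<inter> z ` {1..k} = {}" using disj by blast
  then have cV: "card V = 3 * k"
    unfolding V using disj(1) card_image[OF inj(1)] card_image[OF inj(2)] card_image[OF inj(3)]
    by (simp add: card_Un_disjoint)
  then have "N \<le> card V" by (simp add: k_def)
  with NTL VF have "\<exists>t l A P \<Gamma>.
              1000 \<le> t \<and> t \<le> T \<and> 1 \<le> l \<and> l \<le> L \<and>
              decomposition t l \<epsilon>1 (\<epsilon>2 l) V A P \<and>
              \<Gamma> \<subseteq> nsets {1..t} 2 \<and> real (card \<Gamma>) \<le> \<epsilon>1 * real t ^ 2 \<and>
              (\<forall>i j k. \<forall>\<alpha>\<in>{1..l}. \<forall>\<beta>\<in>{1..l}. \<forall>\<gamma>\<in>{1..l}.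
                 distinct_in t i j k \<and> {i, j} \<notin> \<Gamma> \<and> {i, k} \<notin> \<Gamma> \<and> {j, k} \<notin> \<Gamma> \<longrightarrow>
                 disc23 \<epsilon>1 (\<epsilon>2 l) (A i) (A j) (A k) (triad P i j k \<alpha> \<beta> \<gamma>)
                   (F \<inter> K3 (triad P i j k \<alpha> \<beta> \<gamma>)))"
    by (auto dest!: bspec[OF _ VF])
  then obtain t l A P \<Gamma> where t: "1000 \<le> t" "t \<le> T" and l: "1 \<le> l"
    and dec: "decomposition t l \<epsilon>1 (\<epsilon>2 l) V A P"
    and \<Gamma>: "\<Gamma> \<subseteq> nsets {1..t} 2" "real (card \<Gamma>) \<le> \<epsilon>1 * real t ^ 2"
    and disc: "\<forall>i j k. \<forall>\<alpha>\<in>{1..l}. \<forall>\<beta>\<in>{1..l}. \<forall>\<gamma>\<in>{1..l}.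
                 distinct_in t i j k \<and> {i, j} \<notin> \<Gamma> \<and> {i, k} \<notin> \<Gamma> \<and> {j, k} \<notin> \<Gamma> \<longrightarrow>
                 disc23 \<epsilon>1 (\<epsilon>2 l) (A i) (A j) (A k) (triad P i j k \<alpha> \<beta> \<gamma>)
                   (F \<inter> K3 (triad P i j k \<alpha> \<beta> \<gamma>))"
    by (elim exE conjE)

  \<comment> \<open>Class sizes and the count of bad solutions\<close>
  have VA: "V = (\<Union>i\<in>{1..t}. A i)" and dis: "disjoint_family_on A {1..t}"
    and mono: "\<forall>i\<in>{1..t}. \<forall>j\<in>{1..t}. i \<le> j \<longrightarrow> card (A i) \<le> card (A j)"
    and equi: "card (A t) \<le> card (A 1) + 1"
    and part: "\<forall>i\<in>{1..t}. \<forall>j\<in>{1..t}. i \<noteq> j \<longrightarrow>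
        K2 (A i) (A j) = (\<Union>\<alpha>\<in>{1..l}. P {i, j} \<alpha>) \<and> disjoint_family_on (P {i, j}) {1..l}"
    using dec unfolding decomposition_def by blast+
  have fA: "finite (A i)" if "i \<in> {1..t}" for i
    by (rule finite_subset[OF _ fV]) (use that in \<open>auto simp: VA\<close>)
  have disjA: "A i \<inter> A j = {}" if "i \<in> {1..t}" "j \<in> {1..t}" "i \<noteq> j" for i j
    using dis that by (auto simp: disjoint_family_on_def)
  \<comment> \<open>Twice the average class size \<open>3 * k / t\<close>; the slack covers the
    difference of 1 between class sizes.\<close>
  define m where "m = 6 * real k / real t"
  have kt: "100 * real t \<le> real k" using t(2) by (simp add: k_def)
  have t0: "1000 \<le> real t" using t(1) by simp
  have m: "0 \<le> m" by (simp add: m_def)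
  have Am: "real (card (A i)) \<le> m" if i: "i \<in> {1..t}" for i
  proof -
    have tt: "t \<in> {1..t}" "1 \<in> {1..t}" using t(1) by auto
    have "t * card (A 1) = (\<Sum>j\<in>{1..t}. card (A 1))" by simp
    also have "\<dots> \<le> (\<Sum>j\<in>{1..t}. card (A j))"
      by (rule sum_mono) (use mono tt in auto)
    also have "\<dots> = card V" unfolding VA
      by (rule card_UN_disjoint[symmetric]) (use fA disjA in auto)
    finally have "real t * real (card (A 1)) \<le> 3 * real k"
      unfolding cV by (metis of_nat_le_iff of_nat_mult of_nat_numeral)
    moreover have "card (A i) \<le> card (A t)" using mono i tt by auto
    then have "real (card (A i)) \<le> real (card (A 1)) + 1" using equi by linarith
    then have "real t * real (card (A i)) \<le> real t * (real (card (A 1)) + 1)"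
      by (rule mult_left_mono) simp
    ultimately have "real t * real (card (A i)) \<le> 6 * real k" using kt by (simp add: distrib_left)
    then show ?thesis using t0 by (simp add: m_def field_simps)
  qed
  have "\<forall>v\<in>V. \<exists>i. i \<in> {1..t} \<and> v \<in> A i" by (auto simp: VA)
  then obtain idx where idx: "\<forall>v\<in>V. idx v \<in> {1..t} \<and> v \<in> A (idx v)" by metis
  have fib: "(\<lambda>u. idx (f u)) ` {1..k} \<subseteq> {1..t}" "\<And>i. real (card {u \<in> {1..k}. idx (f u) = i}) \<le> m"
    if f: "inj_on f {1..k}" "f ` {1..k} \<subseteq> V" for f
  proof -
    show sub: "(\<lambda>u. idx (f u)) ` {1..k} \<subseteq> {1..t}" using f idx by blast
    show "real (card {u \<in> {1..k}. idx (f u) = i}) \<le> m" for i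
    proof (cases "i \<in> {1..t}")
      case True
      have "card {u \<in> {1..k}. idx (f u) = i} \<le> card (A i)"
      proof (rule card_inj_on_le[OF inj_on_subset[OF f(1)] _ fA[OF True]])
        show "f ` {u \<in> {1..k}. idx (f u) = i} \<subseteq> A i" using idx f(2) by blast
      qed blast
      then show ?thesis using Am[OF True] by linarith
    next
      case False
      then have "{u \<in> {1..k}. idx (f u) = i} = {}" using sub by blast
      then show ?thesis using m by (simp only: card.empty)
    qed
  qed
  have xV: "x ` {1..k} \<subseteq> V" and yV: "y ` {1..k} \<subseteq> V" and zV: "z ` {1..k} \<subseteq> V"
    by (auto simp: V)
  \<comment> \<open>Since no class exceeds \<open>m\<close>, any \<open>c\<close> vertices of a
    class form at least a \<open>\<delta>\<close> fraction of it.\<close>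
  define c where "c = \<delta> * m"
  have c: "0 \<le> c" using m by (simp add: c_def \<delta>_def)
  \<comment> \<open>The diagonal counts as bad because a triad needs three distinct classes.\<close>
  define G where "G = {(i, j) \<in> {1..t} \<times> {1..t}. i = j \<or> {i, j} \<in> \<Gamma>}"
  have fG: "finite G" unfolding G_def by (rule finite_subset[of _ "{1..t} \<times> {1..t}"]) auto
  have "finite \<Gamma>" using \<Gamma>(1) by (rule finite_subset) (simp add: finite_imp_finite_nsets)
  then have "card G \<le> t + 2 * card \<Gamma>" unfolding G_def by (rule card_related_pairs)
  then have "real (card G) \<le> real t + 2 * real (card \<Gamma>)" by linarith
  moreover have "1000 * real t \<le> real t ^ 2" using t0 by (simp add: power2_eq_square)
  ultimately have "real (card G) \<le> real t ^ 2 / 500"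
    using \<Gamma>(2) by (simp add: \<epsilon>1_def \<delta>_def power3_eq_cube)
  then have "real (card G) * m\<^sup>2 \<le> real t ^ 2 / 500 * m\<^sup>2" by (rule mult_right_mono) simp
  also have "\<dots> = 36 / 500 * real k ^ 2"
    using t0 by (simp add: m_def power2_eq_square)
  finally have Gm: "real (card G) * m\<^sup>2 \<le> 36 / 500 * real k ^ 2" .
  \<comment> \<open>In units of \<open>k ^ 2\<close>, the left side of \<open>small\<close> is at
    most \<open>6 * (6 / 400 + 1 / 100) + 3 * 36 / 500\<close>, which is 0.366.\<close>
  have "real t * (c + 1) * real k = 6 / 400 * real k ^ 2 + real t * real k"
    using t0 by (simp add: c_def m_def \<delta>_def power2_eq_square distrib_left distrib_right)
  moreover have "real t * real k \<le> real k ^ 2 / 100"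
    using mult_right_mono[OF kt, of "real k"] by (simp add: power2_eq_square)
  moreover have "0 < real k ^ 2" using \<open>1 \<le> k\<close> by simp
  ultimately have small: "3 * (2 * real t * (c + 1) * real k) + 3 * (real (card G) * m\<^sup>2) < real k ^ 2 / 2"
    using Gm by linarith

  \<comment> \<open>A central solution and the triad of its densest pair classes\<close>
  define p q r where "p = (\<lambda>u. idx (x u))" "q = (\<lambda>u. idx (y u))" "r = (\<lambda>u. idx (z u))"
  obtain u v w where uvw: "u \<in> {1..k}" "v \<in> {1..k}" "w \<in> {1..k}" "u + v + w = k + 2"
    and central: "u \<notin> peripheral p k c" "v \<notin> peripheral q k c" "w \<notin> peripheral r k c"
    and nG: "(p u, q v) \<notin> G" "(p u, r w) \<notin> G" "(q v, r w) \<notin> G"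
    unfolding p_q_r_def
    by (rule exists_central_solution[OF fib[OF inj(1) xV] fib[OF inj(2) yV] fib[OF inj(3) zV] c fG small])
  have idx_mem: "p u \<in> {1..t}" "q v \<in> {1..t}" "r w \<in> {1..t}"
    using uvw fib(1)[OF inj(1) xV] fib(1)[OF inj(2) yV] fib(1)[OF inj(3) zV]
    unfolding p_q_r_def by blast+
  have ne: "p u \<noteq> q v" "p u \<noteq> r w" "q v \<noteq> r w"
    and n\<Gamma>: "{p u, q v} \<notin> \<Gamma>" "{p u, r w} \<notin> \<Gamma>" "{q v, r w} \<notin> \<Gamma>"
    using nG idx_mem by (simp_all add: G_def)
  \<comment> \<open>Here \<open>f\<close> will be one of the three sides and \<open>R\<close> one of
    the two half-lines at \<open>b\<close>. The bound is relative to the whole class, which may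
    contain vertices of other sides too.\<close>
  have half: "f ` {a \<in> {1..k}. idx (f a) = idx (f b) \<and> R a} \<subseteq> A (idx (f b))"
    "\<delta> * real (card (A (idx (f b)))) \<le> real (card (f ` {a \<in> {1..k}. idx (f a) = idx (f b) \<and> R a}))"
    if f: "inj_on f {1..k}" "f ` {1..k} \<subseteq> V" and b: "b \<in> {1..k}"
      and R: "c \<le> real (card {a \<in> {1..k}. idx (f a) = idx (f b) \<and> R a})" for f b R
  proof -
    show "f ` {a \<in> {1..k}. idx (f a) = idx (f b) \<and> R a} \<subseteq> A (idx (f b))"
    proof clarify
      fix a assume "a \<in> {1..k}" "idx (f a) = idx (f b)"
      then show "f a \<in> A (idx (f b))" using idx f(2) by (metis imageI subsetD)
    qed
    have "idx (f b) \<in> {1..t}" using fib(1)[OF f] b by blast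
    then have "\<delta> * real (card (A (idx (f b)))) \<le> c"
      using Am by (simp add: c_def \<delta>_def)
    moreover have "card (f ` {a \<in> {1..k}. idx (f a) = idx (f b) \<and> R a}) = card {a \<in> {1..k}. idx (f a) = idx (f b) \<and> R a}"
      by (rule card_image[OF inj_on_subset[OF f(1)]]) auto
    ultimately show "\<delta> * real (card (A (idx (f b)))) \<le> real (card (f ` {a \<in> {1..k}. idx (f a) = idx (f b) \<and> R a}))"
      using R by linarith
  qed
  have cen: "c \<le> real (card {a \<in> {1..k}. idx (f a) = idx (f b) \<and> a < b})"
    "c \<le> real (card {a \<in> {1..k}. idx (f a) = idx (f b) \<and> b \<le> a})"
    if "b \<in> {1..k}" "b \<notin> peripheral (\<lambda>u. idx (f u)) k c" for f b
    using that by (auto simp: peripheral_def)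
  note cx = cen[OF uvw(1) central(1)[unfolded p_q_r_def]]
    and cy = cen[OF uvw(2) central(2)[unfolded p_q_r_def]]
    and cz = cen[OF uvw(3) central(3)[unfolded p_q_r_def]]
  \<comment> \<open>Stating the bound for all supersets \<open>E\<close> of the chosen class lets it
    be applied directly to the triad, without computing the part of the triad between two
    classes.\<close>
  have dense: "\<exists>\<alpha>\<in>{1..l}. \<forall>E. P {i, j} \<alpha> \<subseteq> E \<longrightarrow>
      real (card (A i)) * real (card (A j)) \<le> real l * real (card (E \<inter> K2 (A i) (A j)))"
    if ij: "i \<in> {1..t}" "j \<in> {1..t}" "i \<noteq> j" for i j
  proof -
    have un: "(\<Union>\<alpha>\<in>{1..l}. P {i, j} \<alpha>) = K2 (A i) (A j)" using part ij by auto
    obtain \<alpha> where \<alpha>: "\<alpha> \<in> {1..l}" "real (card (K2 (A i) (A j))) \<le> real l * real (card (P {i, j} \<alpha>))"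
      using exists_dense_class[OF l un] by blast
    have fK: "finite (K2 (A i) (A j))"
      by (rule finite_subset[of _ "Pow (A i \<union> A j)"]) (use fA ij in \<open>auto simp: K2_def\<close>)
    have "real (card (A i)) * real (card (A j)) \<le> real l * real (card (E \<inter> K2 (A i) (A j)))"
      if "P {i, j} \<alpha> \<subseteq> E" for E
    proof -
      have "P {i, j} \<alpha> \<subseteq> E \<inter> K2 (A i) (A j)" using that un \<alpha>(1) by blast
      then have "card (P {i, j} \<alpha>) \<le> card (E \<inter> K2 (A i) (A j))"
        using fK by (intro card_mono) auto
      then have "real l * real (card (P {i, j} \<alpha>)) \<le> real l * real (card (E \<inter> K2 (A i) (A j)))"
        by (intro mult_left_mono) auto
      then show ?thesis using \<alpha>(2) card_K2[OF disjA[OF ij]] by simp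
    qed
    then show ?thesis using \<alpha>(1) by blast
  qed
  obtain \<alpha> where \<alpha>: "\<alpha> \<in> {1..l}" "\<And>E. P {p u, q v} \<alpha> \<subseteq> E \<Longrightarrow>
      real (card (A (p u))) * real (card (A (q v))) \<le> real l * real (card (E \<inter> K2 (A (p u)) (A (q v))))"
    using dense[OF idx_mem(1,2) ne(1)] by blast
  obtain \<beta> where \<beta>: "\<beta> \<in> {1..l}" "\<And>E. P {p u, r w} \<beta> \<subseteq> E \<Longrightarrow>
      real (card (A (p u))) * real (card (A (r w))) \<le> real l * real (card (E \<inter> K2 (A (p u)) (A (r w))))"
    using dense[OF idx_mem(1,3) ne(2)] by blast
  obtain \<gamma> where \<gamma>: "\<gamma> \<in> {1..l}" "\<And>E. P {q v, r w} \<gamma> \<subseteq> E \<Longrightarrow>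
      real (card (A (q v))) * real (card (A (r w))) \<le> real l * real (card (E \<inter> K2 (A (q v)) (A (r w))))"
    using dense[OF idx_mem(2,3) ne(3)] by blast
  let ?E = "triad P (p u) (q v) (r w) \<alpha> \<beta> \<gamma>"
  have d23: "disc23 \<epsilon>1 (\<epsilon>2 l) (A (p u)) (A (q v)) (A (r w)) ?E (F \<inter> K3 ?E)"
    using disc[rule_format, OF \<alpha>(1) \<beta>(1) \<gamma>(1)] ne n\<Gamma> idx_mem by (simp add: distinct_in_def)
  have nonempty: "A (p u) \<noteq> {}" "A (q v) \<noteq> {}" "A (r w) \<noteq> {}"
    using idx xV yV zV uvw(1-3) unfolding p_q_r_def by blast+
  have e2: "\<epsilon>2 l \<le> \<delta> ^ 3 / (6 * real l ^ 3)"
  proof -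
    have "real l ^ 3 \<le> (real l + 1) ^ 3" by (rule power_mono) auto
    then show ?thesis using l unfolding \<epsilon>2_def by (intro divide_left_mono) (auto simp: \<delta>_def)
  qed

  \<comment> \<open>The empty box and the full box\<close>
  define X where "X R = x ` {a \<in> {1..k}. idx (x a) = p u \<and> R a}" for R
  define Y where "Y R = y ` {a \<in> {1..k}. idx (y a) = q v \<and> R a}" for R
  define Z where "Z R = z ` {a \<in> {1..k}. idx (z a) = r w \<and> R a}" for R
  note defs = X_def Y_def Z_def p_q_r_def
  have low: "X (\<lambda>a. a < u) \<subseteq> A (p u)" "\<delta> * real (card (A (p u))) \<le> real (card (X (\<lambda>a. a < u)))"
    "Y (\<lambda>a. a < v) \<subseteq> A (q v)" "\<delta> * real (card (A (q v))) \<le> real (card (Y (\<lambda>a. a < v)))"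
    "Z (\<lambda>a. a < w) \<subseteq> A (r w)" "\<delta> * real (card (A (r w))) \<le> real (card (Z (\<lambda>a. a < w)))"
    unfolding defs
    by (fact half[OF inj(1) xV uvw(1) cx(1)] half[OF inj(2) yV uvw(2) cy(1)] half[OF inj(3) zV uvw(3) cz(1)])+
  have high: "X (\<lambda>a. u \<le> a) \<subseteq> A (p u)" "\<delta> * real (card (A (p u))) \<le> real (card (X (\<lambda>a. u \<le> a)))"
    "Y (\<lambda>a. v \<le> a) \<subseteq> A (q v)" "\<delta> * real (card (A (q v))) \<le> real (card (Y (\<lambda>a. v \<le> a)))"
    "Z (\<lambda>a. w \<le> a) \<subseteq> A (r w)" "\<delta> * real (card (A (r w))) \<le> real (card (Z (\<lambda>a. w \<le> a)))"
    unfolding defs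
    by (fact half[OF inj(1) xV uvw(1) cx(2)] half[OF inj(2) yV uvw(2) cy(2)] half[OF inj(3) zV uvw(3) cz(2)])+
  have d1: "P {p u, q v} \<alpha> \<subseteq> ?E" "P {p u, r w} \<beta> \<subseteq> ?E" "P {q v, r w} \<gamma> \<subseteq> ?E"
    by (auto simp: triad_def)
  have params: "1 \<le> real l" "0 < \<delta>" "\<delta> \<le> 1" "0 \<le> \<epsilon>1" "\<epsilon>1 \<le> \<delta> ^ 3 / 64" "0 \<le> \<epsilon>2 l"
    using l by (simp_all add: \<delta>_def \<epsilon>1_def \<epsilon>2_def)
  \<comment> \<open>Indices strictly below \<open>u\<close>, \<open>v\<close>, \<open>w\<close> sum
    to less than \<open>k + 2\<close>, so such a triple is never an edge.\<close>
  have non: "{x', y', z'} \<notin> F \<inter> K3 ?E"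
    if mem: "x' \<in> X (\<lambda>a. a < u)" "y' \<in> Y (\<lambda>a. a < v)" "z' \<in> Z (\<lambda>a. a < w)" for x' y' z'
  proof -
    obtain u' v' w' where "x' = x u'" "y' = y v'" "z' = z w'" "u' \<in> {1..k}" "v' \<in> {1..k}" "w' \<in> {1..k}"
      "u' < u" "v' < v" "w' < w" using mem unfolding defs by blast
    then show ?thesis using edge[of u' v' w'] uvw(4) by simp
  qed
  have yes: "{x', y', z'} \<in> F \<inter> K3 ?E"
    if mem: "x' \<in> X (\<lambda>a. u \<le> a)" "y' \<in> Y (\<lambda>a. v \<le> a)" "z' \<in> Z (\<lambda>a. w \<le> a)"
      and K: "{x', y', z'} \<in> K3 ?E" for x' y' z'
  proof -
    obtain u' v' w' where "x' = x u'" "y' = y v'" "z' = z w'" "u' \<in> {1..k}" "v' \<in> {1..k}" "w' \<in> {1..k}"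
      "u \<le> u'" "v \<le> v'" "w \<le> w'" using mem unfolding defs by blast
    then show ?thesis using edge[of u' v' w'] uvw(4) K by simp
  qed
  show False
    by (rule disc23_contradiction[OF d23 fA[OF idx_mem(1)] fA[OF idx_mem(2)] fA[OF idx_mem(3)] nonempty
      \<alpha>(2)[OF d1(1)] \<beta>(2)[OF d1(2)] \<gamma>(2)[OF d1(3)] params e2 low high non yes])
qed

end
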